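(* Let $\theta$ and $\rho$ be regular infinite cardinals with $\theta < \rho < \kappa$, and let $S$ be a stationary subset of $E^\kappa_\theta$ that reflects fully in $E^\kappa_{\geq\rho}$. Suppose that either $\theta > \omega$, or $\rho \geq \omega_2$. Then, setting $J = NS_\kappa | S$, there is either a descending $(J, I_\kappa)$-tower of length $\mathfrak{b}_\kappa$, or an ascending $(J, I_\kappa)$-tower of length $\kappa^+$.
   Context: $\kappa$ is a regular uncountable cardinal. $acc(\kappa)$ is the set of nonzero limit ordinals below $\kappa$; $E^\kappa_\theta = \{\alpha \in acc(\kappa) : \mathrm{cf}(\alpha) = \theta\}$ and $E^\kappa_{\geq\rho} = \{\alpha \in acc(\kappa) : \mathrm{cf}(\alpha) \geq \rho\}$. A stationary $S \subseteq \kappa$ reflects at $\gamma \in E^\kappa_{\geq\omega_1}$ if $S \cap \gamma$ is stationary in $\gamma$; $S$ reflects fully in a stationary $T \subseteq E^\kappa_{\geq\omega_1}$ if there is a closed unbounded $G \subseteq \kappa$ such that $S$ reflects at every $\gamma \in G \cap T$. $NS_\kappa|S = \{B \subseteq \kappa : B \cap S \text{ is nonstationary}\}$. $I_\kappa$ is the ideal of bounded subsets of $\kappa$. For $f,g \in {}^\kappa\kappa$, $f <^* g$ means $|\{\alpha : f(\alpha)\geq g(\alpha)\}|<\kappa$; $\mathfrak{b}_\kappa$ is the least cardinality of an $F \subseteq {}^\kappa\kappa$ with no $g \in {}^\kappa\kappa$ such that $f <^* g$ for all $f \in F$. For an ideal $J$ on $\kappa$ (with $J^+ = P(\kappa)\setminus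 J$) and $Y \subseteq P(\kappa)$, a descending (respectively, ascending) $(J,Y)$-tower of length $\delta$ is $\langle A_\alpha : \alpha < \delta\rangle$ with each $A_\alpha \in J^+$ such that for $\alpha < \beta < \delta$: $A_\beta \setminus A_\alpha \in Y$ and $A_\alpha \setminus A_\beta \in J^+$ (respectively, $A_\alpha \setminus A_\beta \in Y$ and $A_\beta \setminus A_\alpha \in J^+$). *)

theory Defs
  imports Main "HOL-Library.Equipollence" "HOL-Library.Countable_Set"
begin

text \<open>Convention: the regular uncountable cardinal kappa is represented as the order type
of a well-ordered type 'a; the ordinals below kappa are the elements of 'a.
Subsets of kappa are sets of type 'a set.\<close>

definition is_kappa :: "'a::wellorder itself \<Rightarrow> bool" where
  "is_kappa _ \<longleftrightarrow>
     \<not> countable (UNIV :: 'a set) \<and>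
     (\<forall>a::'a. \<not> (UNIV :: 'a set) \<lesssim> {..<a}) \<and>
     (\<forall>C::'a set. (\<forall>x. \<exists>c\<in>C. x \<le> c) \<longrightarrow> (UNIV :: 'a set) \<lesssim> C)"

definition lim_ord :: "'a::wellorder \<Rightarrow> bool" where
  "lim_ord \<alpha> \<longleftrightarrow> (\<exists>\<beta>. \<beta> < \<alpha>) \<and> (\<forall>\<beta><\<alpha>. \<exists>\<delta>. \<beta> < \<delta> \<and> \<delta> < \<alpha>)"

definition cofinal_in :: "'a::wellorder set \<Rightarrow> 'a \<Rightarrow> bool" where
  "cofinal_in C \<alpha> \<longleftrightarrow> C \<subseteq> {..<\<alpha>} \<and> (\<forall>x<\<alpha>. \<exists>c\<in>C. x \<le> c)"

text \<open>cf(alpha) = theta, for theta an (initial ordinal of a) cardinal\<close>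
definition cf_eq :: "'a::wellorder \<Rightarrow> 'a \<Rightarrow> bool" where
  "cf_eq \<alpha> \<theta> \<longleftrightarrow> (\<exists>C. cofinal_in C \<alpha> \<and> C \<approx> {..<\<theta>}) \<and>
                     (\<forall>C. cofinal_in C \<alpha> \<longrightarrow> {..<\<theta>} \<lesssim> C)"

definition cf_ge :: "'a::wellorder \<Rightarrow> 'a \<Rightarrow> bool" where
  "cf_ge \<alpha> \<rho> \<longleftrightarrow> (\<forall>C. cofinal_in C \<alpha> \<longrightarrow> {..<\<rho>} \<lesssim> C)"

definition is_cardinal :: "'a::wellorder \<Rightarrow> bool" where
  "is_cardinal \<theta> \<longleftrightarrow> (\<forall>\<beta><\<theta>. \<not> {..<\<theta>} \<lesssim> {..<\<beta>})"

definition regular_inf_cardinal :: "'a::wellorder \<Rightarrow> bool" where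
  "regular_inf_cardinal \<theta> \<longleftrightarrow> is_cardinal \<theta> \<and> infinite {..<\<theta>} \<and> cf_eq \<theta> \<theta>"

definition E_cf :: "'a::wellorder \<Rightarrow> 'a set" where
  "E_cf \<theta> = {\<alpha>. lim_ord \<alpha> \<and> cf_eq \<alpha> \<theta>}"

definition E_cf_ge :: "'a::wellorder \<Rightarrow> 'a set" where
  "E_cf_ge \<rho> = {\<alpha>. lim_ord \<alpha> \<and> cf_ge \<alpha> \<rho>}"

text \<open>closed unbounded subset of X, where X is kappa (UNIV) or an ordinal {..<gamma}\<close>
definition club_in :: "'a::wellorder set \<Rightarrow> 'a set \<Rightarrow> bool" where
  "club_in X C \<longleftrightarrow> C \<subseteq> X \<and> (\<forall>x\<in>X. \<exists>c\<in>C. x \<le> c) \<and>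
     (\<forall>\<beta>\<in>X. lim_ord \<beta> \<and> (\<forall>x<\<beta>. \<exists>c\<in>C. x \<le> c \<and> c < \<beta>) \<longrightarrow> \<beta> \<in> C)"

definition stationary_in :: "'a::wellorder set \<Rightarrow> 'a set \<Rightarrow> bool" where
  "stationary_in X S \<longleftrightarrow> S \<subseteq> X \<and> (\<forall>C. club_in X C \<longrightarrow> S \<inter> C \<noteq> {})"

definition reflects_at :: "'a::wellorder set \<Rightarrow> 'a \<Rightarrow> bool" where
  "reflects_at S \<gamma> \<longleftrightarrow> stationary_in {..<\<gamma>} (S \<inter> {..<\<gamma>})"

definition reflects_fully :: "'a::wellorder set \<Rightarrow> 'a set \<Rightarrow> bool" where
  "reflects_fully S T \<longleftrightarrow> (\<exists>G. club_in UNIV G \<and> (\<forall>\<gamma>\<in>G \<inter> T. reflects_at S \<gamma>))"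

definition NS_restr :: "'a::wellorder set \<Rightarrow> 'a set set" where
  "NS_restr S = {B. \<not> stationary_in UNIV (B \<inter> S)}"

definition bounded_ideal :: "'a::wellorder set set" where
  "bounded_ideal = {B. \<exists>a. B \<subseteq> {..<a}}"

definition lt_star :: "('a::wellorder \<Rightarrow> 'a) \<Rightarrow> ('a \<Rightarrow> 'a) \<Rightarrow> bool" where
  "lt_star f g \<longleftrightarrow> \<not> (UNIV :: 'a set) \<lesssim> {\<alpha>. g \<alpha> \<le> f \<alpha>}"

definition unbounded_family :: "('a::wellorder \<Rightarrow> 'a) set \<Rightarrow> bool" where
  "unbounded_family F \<longleftrightarrow> \<not> (\<exists>g. \<forall>f\<in>F. lt_star f g)"

definition has_length_bfrak :: "'a::wellorder itself \<Rightarrow> 'i rel \<Rightarrow> bool" where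
  "has_length_bfrak _ w \<longleftrightarrow> Well_order w \<and>
     (\<exists>F :: ('a \<Rightarrow> 'a) set. unbounded_family F \<and> Field w \<approx> F \<and>
        (\<forall>G :: ('a \<Rightarrow> 'a) set. unbounded_family G \<longrightarrow> F \<lesssim> G)) \<and>
     (\<forall>i\<in>Field w. \<not> Field w \<lesssim> underS w i)"

definition has_length_kplus :: "'a::wellorder itself \<Rightarrow> 'i rel \<Rightarrow> bool" where
  "has_length_kplus _ w \<longleftrightarrow> Well_order w \<and>
     \<not> Field w \<lesssim> (UNIV :: 'a set) \<and>
     (\<forall>i\<in>Field w. underS w i \<lesssim> (UNIV :: 'a set))"

definition desc_tower :: "'a set set \<Rightarrow> 'a set set \<Rightarrow> 'i rel \<Rightarrow> ('i \<Rightarrow> 'a set) \<Rightarrow> bool" where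
  "desc_tower J Y w A \<longleftrightarrow> (\<forall>i\<in>Field w. A i \<notin> J) \<and>
     (\<forall>i j. (i, j) \<in> w \<and> i \<noteq> j \<longrightarrow> A j - A i \<in> Y \<and> A i - A j \<notin> J)"

definition asc_tower :: "'a set set \<Rightarrow> 'a set set \<Rightarrow> 'i rel \<Rightarrow> ('i \<Rightarrow> 'a set) \<Rightarrow> bool" where
  "asc_tower J Y w A \<longleftrightarrow> (\<forall>i\<in>Field w. A i \<notin> J) \<and>
     (\<forall>i j. (i, j) \<in> w \<and> i \<noteq> j \<longrightarrow> A i - A j \<in> Y \<and> A j - A i \<notin> J)"

end

theory Submission
  imports Defs
begin

text \<open>
  The second alternative always holds. Suppose there is no ascending tower of length $\kappa^+$. Every
  stationary subset of \<open>S\<close> carries a sequence of cofinal sets $B_\delta \subseteq \delta$, made of points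
  of cofinality at least \<open>\<rho>\<close>, that guesses clubs: for each club \<open>D\<close>, stationarily often
  $B_\delta$ is almost contained in \<open>D\<close>. The sets of \<open>\<delta>\<close> at which the
  guess succeeds decrease with \<open>D\<close>; without a tower they stabilise modulo the nonstationary ideal,
  and sequences obtained on different parts of \<open>S\<close> can be glued. Hence one sequence on \<open>S\<close> is almost
  contained in every club \<open>D\<close> at all but nonstationarily many \<open>\<delta>\<close>.

  Iterate: let $D_j$ be contained in the limit points of $D_i$, and let $B_\delta$ be almost
  contained in $D_i$ for all $\delta \in S \cap D_j$, whenever $i < j < \mu$. Let \<open>\<gamma>\<close> be the least limit
  point of $K = \bigcap_i D_i$ of cofinality at least \<open>\<rho>\<close>. As \<open>S\<close> reflects at \<open>\<gamma>\<close>, it has an element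
  $\delta < \gamma$ in \<open>K\<close>, and $B_\delta$ then contains a smaller limit point of \<open>K\<close> of cofinality at
  least \<open>\<rho>\<close>, a contradiction.
\<close>

subsection \<open>Clubs, limit points and families too small to be cofinal in a regular cardinal\<close>

definition limp :: "'a::wellorder set \<Rightarrow> 'a set" where
  "limp A = {\<beta>. lim_ord \<beta> \<and> (\<forall>x<\<beta>. \<exists>c\<in>A. x \<le> c \<and> c < \<beta>)}"

lemma limpI: "lim_ord y \<Longrightarrow> (\<And>z. z < y \<Longrightarrow> \<exists>c\<in>A. z \<le> c \<and> c < y) \<Longrightarrow> y \<in> limp A"
  by (simp add: limp_def)

lemma limp_strict:
  assumes "y \<in> limp A" "z < y"
  obtains c where "c \<in> A" "z < c" "c < y"
proof -
  obtain w where "z < w" "w < y"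
    using assms by (auto simp: limp_def lim_ord_def)
  then obtain c where "c \<in> A" "w \<le> c" "c < y"
    using assms by (auto simp: limp_def)
  with \<open>z < w\<close> that show ?thesis by force
qed

lemma limp_mono: "A \<subseteq> B \<Longrightarrow> limp A \<subseteq> limp B"
  by (force simp: limp_def)

lemma limp_limp: "limp (A \<union> limp A) \<subseteq> limp A"
proof
  fix y assume y: "y \<in> limp (A \<union> limp A)"
  show "y \<in> limp A"
  proof (rule limpI)
    show "lim_ord y" using y by (simp add: limp_def)
    fix z assume "z < y"
    then obtain c where c: "c \<in> A \<union> limp A" "z < c" "c < y"
      using limp_strict[OF y] by blast
    show "\<exists>c\<in>A. z \<le> c \<and> c < y"
    proof (cases "c \<in> A")
      case True
      then show ?thesis using c by (meson less_imp_le)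
    next
      case False
      then have "c \<in> limp A" using c by blast
      then obtain d where "d \<in> A" "z < d" "d < c" using limp_strict c by blast
      then show ?thesis using c by (meson less_imp_le order.strict_trans)
    qed
  qed
qed

lemma club_UNIV_iff: "club_in UNIV C \<longleftrightarrow> (\<forall>x. \<exists>c\<in>C. x \<le> c) \<and> limp C \<subseteq> C"
  by (auto simp: club_in_def limp_def)

text \<open>A closing-off argument: \<open>y\<close> is the supremum of an omega-sequence chosen by
  \<open>step\<close>, so pairs related by \<open>R\<close> occur cofinally below it. The set
  \<open>X\<close> stands for kappa or for an ordinal in which countable sequences are
  bounded.\<close>

lemma omega_limit:
  fixes X :: "'a::wellorder set"
  assumes down: "\<And>x y. y \<in> X \<Longrightarrow> x \<le> y \<Longrightarrow> x \<in> X"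
    and bdd: "\<And>f :: nat \<Rightarrow> 'a. (\<And>n. f n \<in> X) \<Longrightarrow> \<exists>b\<in>X. \<forall>n. f n < b"
    and step: "\<And>x. x \<in> X \<Longrightarrow> \<exists>b\<in>X. x < b \<and> R x b"
    and x: "x \<in> X"
  shows "\<exists>y\<in>X. lim_ord y \<and> x < y \<and> (\<forall>z<y. \<exists>u v. z < u \<and> u < v \<and> v < y \<and> R u v)"
proof -
  have "\<exists>f. \<forall>n. (f n \<in> X \<and> (n = 0 \<longrightarrow> f n = x)) \<and> (f n < f (Suc n) \<and> R (f n) (f (Suc n)))"
    by (rule dependent_nat_choice) (use step x in auto)
  then obtain f where f: "\<And>n. f n \<in> X" "f 0 = x" "\<And>n. f n < f (Suc n)" "\<And>n. R (f n) (f (Suc n))"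
    by blast
  obtain b where b: "b \<in> X" "\<forall>n. f n < b" using bdd f(1) by blast
  define y where "y = (LEAST u. \<forall>n. f n < u)"
  have y: "f n < y" for n
    unfolding y_def using LeastI[of "\<lambda>u. \<forall>n. f n < u"] b by blast
  have "y \<le> b" unfolding y_def using b by (auto intro: Least_le)
  have ex: "\<exists>n. z < f n" if "z < y" for z
  proof -
    have "\<not> (\<forall>n. f n < z)" using that not_less_Least unfolding y_def by blast
    then obtain n where "z \<le> f n" using not_le by blast
    then show ?thesis using f(3)[of n] by (meson order_le_less_trans)
  qed
  show ?thesis
  proof (intro bexI conjI allI impI)
    show "y \<in> X" using down b(1) \<open>y \<le> b\<close> by blast
    show "x < y" using y[of 0] f by simp
    show "lim_ord y" unfolding lim_ord_def using y ex by blast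
    show "\<exists>u v. z < u \<and> u < v \<and> v < y \<and> R u v" if "z < y" for z
      using ex[OF that] f y by blast
  qed
qed

text \<open>Apply \<open>omega_limit\<close> to the relation that every \<open>C i\<close> has an
  element from \<open>u\<close> up to \<open>v\<close>: the point obtained is a limit of each
  \<open>C i\<close>. The general \<open>X\<close> allows use both in kappa and inside an ordinal of
  large cofinality.\<close>

lemma club_INT:
  fixes X :: "'a::wellorder set" and I :: "'i set"
  assumes down: "\<And>x y. y \<in> X \<Longrightarrow> x \<le> y \<Longrightarrow> x \<in> X"
    and bdd: "\<And>f :: nat \<Rightarrow> 'a. (\<And>n. f n \<in> X) \<Longrightarrow> \<exists>b\<in>X. \<forall>n. f n < b"
    and bddI: "\<And>f :: 'i \<Rightarrow> 'a. (\<And>i. i \<in> I \<Longrightarrow> f i \<in> X) \<Longrightarrow> \<exists>b\<in>X. \<forall>i\<in>I. f i < b"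
    and C: "\<And>i. i \<in> I \<Longrightarrow> club_in X (C i)"
  shows "club_in X (X \<inter> (\<Inter>i\<in>I. C i))"
  unfolding club_in_def
proof (intro conjI ballI impI)
  fix x assume x: "x \<in> X"
  have step: "\<exists>b\<in>X. x < b \<and> (\<forall>i\<in>I. \<exists>c\<in>C i. x \<le> c \<and> c < b)" if x: "x \<in> X" for x
  proof -
    have "\<forall>i\<in>I. \<exists>c. c \<in> C i \<and> x \<le> c"
      using C x unfolding club_in_def by blast
    then obtain f where f: "\<And>i. i \<in> I \<Longrightarrow> f i \<in> C i \<and> x \<le> f i" by metis
    then have "f i \<in> X" if "i \<in> I" for i using C that unfolding club_in_def by blast
    then obtain b where b: "b \<in> X" "\<forall>i\<in>I. f i < b" using bddI by blast
    obtain d where d: "d \<in> X" "x < d" using bdd[of "\<lambda>_. x"] x by auto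
    have "max b d \<in> X" using b d by (simp add: max_def)
    moreover have "x < max b d" using d by (simp add: less_max_iff_disj)
    moreover have "\<forall>i\<in>I. \<exists>c\<in>C i. x \<le> c \<and> c < max b d"
      using f b by (meson less_max_iff_disj)
    ultimately show ?thesis by blast
  qed
  have "\<exists>y\<in>X. lim_ord y \<and> x < y \<and>
      (\<forall>z<y. \<exists>u v. z < u \<and> u < v \<and> v < y \<and> (\<forall>i\<in>I. \<exists>c\<in>C i. u \<le> c \<and> c < v))"
    by (rule omega_limit[OF down bdd]) (use step x in blast)+
  then obtain y where y: "y \<in> X" "lim_ord y" "x < y"
    and yR: "\<forall>z<y. \<exists>u v. z < u \<and> u < v \<and> v < y \<and> (\<forall>i\<in>I. \<exists>c\<in>C i. u \<le> c \<and> c < v)"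
    by blast
  have "y \<in> C i" if "i \<in> I" for i
  proof -
    have "\<exists>c\<in>C i. z \<le> c \<and> c < y" if "z < y" for z
    proof -
      obtain u v c where "z < u" "v < y" "c \<in> C i" "u \<le> c" "c < v"
        using yR \<open>z < y\<close> \<open>i \<in> I\<close> by meson
      then show ?thesis by (intro bexI[of _ c]) auto
    qed
    then show ?thesis using C[OF that] y unfolding club_in_def by blast
  qed
  then show "\<exists>c\<in>X \<inter> (\<Inter>i\<in>I. C i). x \<le> c" using y by (auto intro!: bexI[of _ y])
next
  fix \<beta> assume \<beta>: "\<beta> \<in> X" "lim_ord \<beta> \<and> (\<forall>x<\<beta>. \<exists>c\<in>X \<inter> (\<Inter>i\<in>I. C i). x \<le> c \<and> c < \<beta>)"
  have "\<beta> \<in> C i" if "i \<in> I" for i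
  proof -
    have "\<forall>x<\<beta>. \<exists>c\<in>C i. x \<le> c \<and> c < \<beta>"
      using \<beta>(2) that by (meson INT_E IntE)
    then show ?thesis using C[OF that] \<beta> unfolding club_in_def by simp
  qed
  then show "\<beta> \<in> X \<inter> (\<Inter>i\<in>I. C i)" using \<beta> by blast
qed simp

section \<open>Families of size less than a regular cardinal\<close>

text \<open>For regular \<open>\<rho>\<close> this amounts to size less than \<open>\<rho>\<close>,
  by \<open>rbdd_small\<close>, \<open>not_rbdd_self\<close> and \<open>rbdd_lepoll\<close>. In
  terms of bounds, closure under unions is just bounding twice, without cardinal arithmetic.\<close>

definition rbdd :: "'a::wellorder \<Rightarrow> 'b set \<Rightarrow> bool" where
  "rbdd \<rho> W \<longleftrightarrow> (\<forall>f. (\<forall>w\<in>W. f w < \<rho>) \<longrightarrow> (\<exists>b<\<rho>. \<forall>w\<in>W. f w \<le> b))"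

lemma rbddD: "rbdd \<rho> W \<Longrightarrow> (\<And>w. w \<in> W \<Longrightarrow> f w < \<rho>) \<Longrightarrow> \<exists>b<\<rho>. \<forall>w\<in>W. f w \<le> b"
  unfolding rbdd_def by blast

lemma finite_if_lepoll: "A \<lesssim> B \<Longrightarrow> finite B \<Longrightarrow> finite A"
  by (meson infinite_le_lepoll lepoll_trans)

text \<open>Take \<open>m\<close> where the least value is attained: a decreasing function cannot
  leave its minimum.\<close>

lemma eventually_constant:
  fixes g :: "'a::wellorder \<Rightarrow> 'b::wellorder"
  assumes dec: "\<And>i j. i \<le> j \<Longrightarrow> j < \<rho> \<Longrightarrow> g j \<le> g i" and "i0 < \<rho>"
  shows "\<exists>m<\<rho>. \<forall>j. m \<le> j \<longrightarrow> j < \<rho> \<longrightarrow> g j = g m"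
proof -
  define y where "y = (LEAST y. \<exists>i<\<rho>. y = g i)"
  have "\<exists>i<\<rho>. y = g i"
    unfolding y_def by (rule LeastI_ex) (use assms in blast)
  then obtain m where m: "m < \<rho>" "y = g m" by blast
  have "y \<le> g j" if "j < \<rho>" for j
    unfolding y_def using that by (auto intro: Least_le)
  then show ?thesis using m dec by (metis order_antisym)
qed

context
  fixes \<rho> :: "'a::wellorder"
  assumes reg: "regular_inf_cardinal \<rho>"
begin

lemma regular_lim_ord: "lim_ord \<rho>"
  unfolding lim_ord_def
proof (intro conjI allI impI)
  have inf: "infinite {..<\<rho>}" using reg by (simp add: regular_inf_cardinal_def)
  show "\<exists>\<beta>. \<beta> < \<rho>" using infinite_imp_nonempty[OF inf] by auto
  fix \<beta> assume "\<beta> < \<rho>"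
  show "\<exists>\<delta>>\<beta>. \<delta> < \<rho>"
  proof (rule ccontr)
    assume "\<not> ?thesis"
    then have "cofinal_in {\<beta>} \<rho>"
      using \<open>\<beta> < \<rho>\<close> unfolding cofinal_in_def by (auto simp: not_less)
    then have "{..<\<rho>} \<lesssim> {\<beta>}" using reg unfolding regular_inf_cardinal_def cf_eq_def by blast
    then show False using inf finite_if_lepoll by blast
  qed
qed

lemma rbdd_small: "\<not> {..<\<rho>} \<lesssim> W \<Longrightarrow> rbdd \<rho> W"
  unfolding rbdd_def
proof (intro allI impI)
  fix f :: "'b \<Rightarrow> 'a"
  assume small: "\<not> {..<\<rho>} \<lesssim> W" and f: "\<forall>w\<in>W. f w < \<rho>"
  show "\<exists>b<\<rho>. \<forall>w\<in>W. f w \<le> b"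
  proof (rule ccontr)
    assume "\<not> ?thesis"
    then have "cofinal_in (f ` W) \<rho>"
      using f unfolding cofinal_in_def by (auto simp: not_le) (meson less_imp_le)
    then have "{..<\<rho>} \<lesssim> f ` W" using reg unfolding regular_inf_cardinal_def cf_eq_def by blast
    with small show False using image_lepoll lepoll_trans by blast
  qed
qed

lemma not_rbdd_self: "\<not> rbdd \<rho> {..<\<rho>}"
proof
  assume "rbdd \<rho> {..<\<rho>}"
  then have "\<exists>b<\<rho>. \<forall>w\<in>{..<\<rho>}. w \<le> b"
    by (rule rbddD) simp
  then show False using regular_lim_ord unfolding lim_ord_def by (metis lessThan_iff not_less)
qed

lemma rbdd_subset:
  assumes W: "rbdd \<rho> W" and V: "V \<subseteq> W"
  shows "rbdd \<rho> V"
  unfolding rbdd_def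
proof (intro allI impI)
  fix f :: "'b \<Rightarrow> 'a" assume f: "\<forall>w\<in>V. f w < \<rho>"
  \<comment> \<open>\<open>a\<close> is the default value that extends \<open>f\<close> from
    \<open>V\<close> to \<open>W\<close>.\<close>
  obtain a where "a < \<rho>" using regular_lim_ord unfolding lim_ord_def by blast
  then have "\<exists>b<\<rho>. \<forall>w\<in>W. (if w \<in> V then f w else a) \<le> b"
    by (intro rbddD[OF W]) (use f in auto)
  then obtain b where b: "b < \<rho>" "\<forall>w\<in>W. (if w \<in> V then f w else a) \<le> b" by blast
  have "f w \<le> b" if "w \<in> V" for w
    using b(2)[rule_format, of w] V that by auto
  then show "\<exists>b<\<rho>. \<forall>w\<in>V. f w \<le> b" using b(1) by blast
qed

lemma rbdd_image: "rbdd \<rho> W \<Longrightarrow> rbdd \<rho> (g ` W)"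
  unfolding rbdd_def
proof (intro allI impI)
  fix f :: "'c \<Rightarrow> 'a"
  assume W: "\<forall>f. (\<forall>w\<in>W. f w < \<rho>) \<longrightarrow> (\<exists>b<\<rho>. \<forall>w\<in>W. f w \<le> b)" and f: "\<forall>w\<in>g ` W. f w < \<rho>"
  then show "\<exists>b<\<rho>. \<forall>w\<in>g ` W. f w \<le> b"
    using W[rule_format, of "f \<circ> g"] by auto
qed

lemma rbdd_lepoll:
  assumes "rbdd \<rho> W" "V \<lesssim> W"
  shows "rbdd \<rho> V"
proof -
  obtain h where h: "inj_on h V" "h ` V \<subseteq> W" using assms unfolding lepoll_def by blast
  have "rbdd \<rho> (h ` V)" using rbdd_subset[OF assms(1) h(2)] .
  then have "rbdd \<rho> (inv_into V h ` h ` V)" by (rule rbdd_image)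
  then show ?thesis using h by simp
qed

lemma rbdd_UN:
  assumes A: "rbdd \<rho> A" and W: "\<And>a. a \<in> A \<Longrightarrow> rbdd \<rho> (W a)"
  shows "rbdd \<rho> (\<Union>a\<in>A. W a)"
  unfolding rbdd_def
proof (intro allI impI)
  fix f :: "'c \<Rightarrow> 'a" assume f: "\<forall>w\<in>\<Union>a\<in>A. W a. f w < \<rho>"
  have "\<exists>b<\<rho>. \<forall>w\<in>W a. f w \<le> b" if "a \<in> A" for a
    using W[OF that] f that unfolding rbdd_def by blast
  then obtain b where b: "\<And>a. a \<in> A \<Longrightarrow> b a < \<rho> \<and> (\<forall>w\<in>W a. f w \<le> b a)" by metis
  then have "\<exists>c<\<rho>. \<forall>a\<in>A. b a \<le> c" by (intro rbddD[OF A]) blast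
  then obtain c where c: "c < \<rho>" "\<forall>a\<in>A. b a \<le> c" by blast
  have "f w \<le> c" if "w \<in> W a" "a \<in> A" for w a
    using b[OF that(2)] c(2) that by (meson order_trans)
  then show "\<exists>b<\<rho>. \<forall>w\<in>\<Union>a\<in>A. W a. f w \<le> b" using c(1) by blast
qed

lemma rbdd_finite:
  assumes "finite W" shows "rbdd \<rho> W"
proof (rule rbdd_small)
  show "\<not> {..<\<rho>} \<lesssim> W"
    using assms reg finite_if_lepoll unfolding regular_inf_cardinal_def by blast
qed

lemma rbdd_insert:
  assumes "rbdd \<rho> W" shows "rbdd \<rho> (insert a W)"
  unfolding rbdd_def
proof (intro allI impI)
  fix f :: "'b \<Rightarrow> 'a" assume f: "\<forall>w\<in>insert a W. f w < \<rho>"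
  then have "\<exists>b<\<rho>. \<forall>w\<in>W. f w \<le> b" by (intro rbddD[OF assms]) simp
  then obtain b where "b < \<rho>" "\<forall>w\<in>W. f w \<le> b" by blast
  with f show "\<exists>b<\<rho>. \<forall>w\<in>insert a W. f w \<le> b"
    by (intro exI[of _ "max b (f a)"]) (simp add: max.coboundedI1)
qed

lemma not_lepoll_smaller: "\<mu> < \<rho> \<Longrightarrow> \<not> {..<\<rho>} \<lesssim> {..<\<mu>}"
  using reg unfolding regular_inf_cardinal_def is_cardinal_def by blast

lemma cf_eq_not_cf_ge:
  assumes "cf_eq \<delta> \<theta>" "\<theta> < \<rho>"
  shows "\<not> cf_ge \<delta> \<rho>"
proof
  assume *: "cf_ge \<delta> \<rho>"
  obtain C where "cofinal_in C \<delta>" "C \<approx> {..<\<theta>}"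
    using assms(1) unfolding cf_eq_def by blast
  moreover from this have "{..<\<rho>} \<lesssim> C" using * unfolding cf_ge_def by blast
  ultimately have "{..<\<rho>} \<lesssim> C" "C \<approx> {..<\<theta>}" by blast+
  then show False using not_lepoll_smaller[OF assms(2)] lepoll_trans2 by blast
qed

lemma cf_ge_bdd:
  assumes "lim_ord \<gamma>" "cf_ge \<gamma> \<rho>" "\<not> {..<\<rho>} \<lesssim> I" "\<And>i. i \<in> I \<Longrightarrow> f i < \<gamma>"
  shows "\<exists>b\<in>{..<\<gamma>}. \<forall>i\<in>I. f i < b"
proof (rule ccontr)
  assume *: "\<not> ?thesis"
  have "cofinal_in (f ` I) \<gamma>"
    unfolding cofinal_in_def using assms(4) * by (auto simp: not_less)
  then have "{..<\<rho>} \<lesssim> f ` I" using assms(2) unfolding cf_ge_def by blast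
  then show False using assms(3) image_lepoll lepoll_trans by blast
qed

end

section \<open>Clubs and stationary subsets of kappa\<close>

locale regular_uncountable =
  fixes type_token :: "'a::wellorder itself"
  assumes kappa: "is_kappa TYPE('a)"
begin

lemma small_bdd:
  fixes f :: "'i \<Rightarrow> 'a"
  assumes "\<not> (UNIV :: 'a set) \<lesssim> I"
  shows "\<exists>b. \<forall>i\<in>I. f i < b"
proof (rule ccontr)
  assume "\<not> ?thesis"
  then have "\<forall>x. \<exists>c\<in>f ` I. x \<le> c" by (auto simp: not_less)
  then have "(UNIV :: 'a set) \<lesssim> f ` I" using kappa unfolding is_kappa_def by blast
  then show False using assms image_lepoll lepoll_trans by blast
qed

lemma not_lepoll_initial: "\<not> (UNIV :: 'a set) \<lesssim> {..<a::'a}"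
  using kappa unfolding is_kappa_def by blast

lemma not_lepoll_countable: "countable I \<Longrightarrow> \<not> (UNIV :: 'a set) \<lesssim> I"
  using kappa countable_lepoll unfolding is_kappa_def by blast

lemma nat_bdd: "\<exists>b. \<forall>n::nat. f n < (b::'a)"
  using small_bdd[OF not_lepoll_countable[of "UNIV :: nat set"]] by auto

lemma ex_gt: "\<exists>b. (a::'a) < b"
  using nat_bdd[of "\<lambda>_. a"] by blast

lemma club_Inter:
  assumes "\<not> (UNIV :: 'a set) \<lesssim> I" "\<And>i. i \<in> I \<Longrightarrow> club_in UNIV (C i)"
  shows "club_in (UNIV :: 'a set) (\<Inter>i\<in>I. C i)"
  using club_INT[of "UNIV :: 'a set" I C] assms small_bdd[OF assms(1)] nat_bdd by simp

lemma club_Int: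
  assumes "club_in UNIV C" "club_in (UNIV :: 'a set) D"
  shows "club_in UNIV (C \<inter> D)"
  using club_Inter[of "UNIV :: bool set" "\<lambda>b. if b then C else D"] assms
    not_lepoll_countable[of "UNIV :: bool set"]
  by (simp add: UNIV_bool Int_commute)

lemma club_UNIV: "club_in UNIV (UNIV :: 'a set)"
  by (auto simp: club_UNIV_iff)

lemma club_greaterThan: "club_in UNIV {a::'a<..}"
  unfolding club_UNIV_iff
proof (intro conjI allI)
  fix x show "\<exists>c\<in>{a<..}. x \<le> c" using ex_gt[of "max a x"] by (auto intro: less_imp_le)
  show "limp {a<..} \<subseteq> {a<..}"
    by (auto simp: limp_def lim_ord_def)
qed

lemma omega_limit_UNIV:
  assumes "\<And>x. \<exists>b>x. R x b"
  shows "\<exists>y::'a. lim_ord y \<and> x < y \<and> (\<forall>z<y. \<exists>u v. z < u \<and> u < v \<and> v < y \<and> R u v)"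
  using omega_limit[of "UNIV :: 'a set" R x] assms nat_bdd by auto

lemma club_unbdd:
  assumes "club_in UNIV (C :: 'a set)"
  shows "\<exists>c\<in>C. x < c"
  using assms ex_gt[of x] unfolding club_UNIV_iff by (meson order_less_le_trans)

lemma club_limp:
  assumes "club_in UNIV (C :: 'a set)"
  shows "club_in UNIV (limp C)"
  unfolding club_UNIV_iff
proof (intro conjI allI)
  fix x
  have "\<exists>b>x. \<exists>c\<in>C. x \<le> c \<and> c < b" for x
    using club_unbdd[OF assms, of x] ex_gt by (meson less_imp_le order.strict_trans)
  then obtain y where y: "lim_ord y" "x < y"
    and yR: "\<forall>z<y. \<exists>u v. z < u \<and> u < v \<and> v < y \<and> (\<exists>c\<in>C. u \<le> c \<and> c < v)"
    using omega_limit_UNIV[of "\<lambda>x b. \<exists>c\<in>C. x \<le> c \<and> c < b" x] by blast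
  have "y \<in> limp C"
  proof (rule limpI[OF y(1)])
    fix z assume "z < y"
    then obtain u v c where "z < u" "v < y" "c \<in> C" "u \<le> c" "c < v" using yR by meson
    then show "\<exists>c\<in>C. z \<le> c \<and> c < y" by (intro bexI[of _ c]) auto
  qed
  then show "\<exists>c\<in>limp C. x \<le> c" using y by (meson less_imp_le)
qed (use limp_limp limp_mono in blast)

text \<open>The diagonal intersection. The relation \<open>?R u v\<close> concerns only the indices
  below \<open>u\<close>, fewer than kappa many, so a suitable \<open>v\<close> exists; below a
  limit \<open>y\<close> of such steps, every index under \<open>y\<close> is eventually
  covered.\<close>

lemma club_diag:
  assumes E: "\<And>x. club_in UNIV (E x :: 'a set)"
  shows "club_in UNIV {\<delta>. \<forall>x<\<delta>. \<delta> \<in> E x}"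
  unfolding club_UNIV_iff
proof (intro conjI allI)
  fix x
  let ?R = "\<lambda>u v. \<forall>\<xi><u. \<exists>c\<in>E \<xi>. u \<le> c \<and> c < v"
  have "\<exists>b>x. ?R x b" for x
  proof -
    have "\<exists>c. c \<in> E \<xi> \<and> x \<le> c" for \<xi>
      using E[of \<xi>] unfolding club_UNIV_iff by blast
    then obtain c where c: "\<And>\<xi>. c \<xi> \<in> E \<xi> \<and> x \<le> c \<xi>" by metis
    obtain b where "\<forall>\<xi>\<in>{..<x}. c \<xi> < b" using small_bdd[OF not_lepoll_initial] by blast
    moreover obtain d where "x < d" using ex_gt by blast
    ultimately show ?thesis using c
      by (intro exI[of _ "max b d"]) (auto simp: less_max_iff_disj intro!: bexI[of _ "c _"])
  qed
  then obtain y where y: "lim_ord y" "x < y"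
    and yR: "\<forall>z<y. \<exists>u v. z < u \<and> u < v \<and> v < y \<and> ?R u v"
    using omega_limit_UNIV[of ?R x] by blast
  have "y \<in> E \<xi>" if "\<xi> < y" for \<xi>
  proof -
    have "y \<in> limp (E \<xi>)"
    proof (rule limpI[OF y(1)])
      fix z assume "z < y"
      then have "max z \<xi> < y" using that by simp
      then obtain u v where uv: "max z \<xi> < u" "v < y" "?R u v" using yR by blast
      then obtain c where "c \<in> E \<xi>" "u \<le> c" "c < v" by auto
      with uv show "\<exists>c\<in>E \<xi>. z \<le> c \<and> c < y" by (intro bexI[of _ c]) auto
    qed
    then show ?thesis using E[of \<xi>] unfolding club_UNIV_iff by blast
  qed
  then show "\<exists>c\<in>{\<delta>. \<forall>x<\<delta>. \<delta> \<in> E x}. x \<le> c" using y(2) by (intro bexI[of _ y]) auto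
next
  show "limp {\<delta>. \<forall>x<\<delta>. \<delta> \<in> E x} \<subseteq> {\<delta>. \<forall>x<\<delta>. \<delta> \<in> E x}"
  proof (intro subsetI CollectI allI impI)
    fix y \<xi> assume y: "y \<in> limp {\<delta>. \<forall>x<\<delta>. \<delta> \<in> E x}" and "\<xi> < y"
    have "y \<in> limp (E \<xi>)"
    proof (rule limpI)
      show "lim_ord y" using y by (simp add: limp_def)
      fix z assume "z < y"
      then have "max z \<xi> < y" using \<open>\<xi> < y\<close> by simp
      with y obtain c where "c \<in> {\<delta>. \<forall>x<\<delta>. \<delta> \<in> E x}" "max z \<xi> < c" "c < y"
        by (rule limp_strict)
      then show "\<exists>c\<in>E \<xi>. z \<le> c \<and> c < y"
        by (intro bexI[of _ c]) auto
    qed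
    then show "y \<in> E \<xi>" using E[of \<xi>] unfolding club_UNIV_iff by blast
  qed
qed

abbreviation stat :: "'a set \<Rightarrow> bool" where
  "stat \<equiv> stationary_in UNIV"

lemma statD: "stat T \<Longrightarrow> club_in UNIV C \<Longrightarrow> \<exists>x. x \<in> T \<and> x \<in> C"
  unfolding stationary_in_def by blast

lemma stat_mono: "stat T \<Longrightarrow> T \<subseteq> U \<Longrightarrow> stat U"
  unfolding stationary_in_def by blast

lemma stat_Int_club: "stat T \<Longrightarrow> club_in UNIV E \<Longrightarrow> stat (T \<inter> E)"
  using club_Int unfolding stationary_in_def by (metis Int_assoc subset_UNIV)

lemma not_statE:
  assumes "\<not> stat T"
  obtains E where "club_in UNIV E" "T \<inter> E = {}"
  using assms unfolding stationary_in_def by blast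

end

subsection \<open>Club guessing by points of large cofinality\<close>

text \<open>Uncountability of \<open>\<rho>\<close> bounds omega-sequences below points of
  cofinality at least \<open>\<rho>\<close>, and lets the countably many levels of a tree be handled
  at once.\<close>

locale reflecting_setup = regular_uncountable type_token
  for type_token :: "'a::wellorder itself" +
  fixes \<theta> \<rho> :: 'a and S :: "'a set"
  assumes \<rho>: "regular_inf_cardinal \<rho>"
    and \<theta>\<rho>: "\<theta> < \<rho>"
    and uncountable_\<rho>: "uncountable {..<\<rho>}"
    and S: "S \<subseteq> E_cf \<theta>"
begin

lemma S_lim_ord: "\<delta> \<in> S \<Longrightarrow> lim_ord \<delta>"
  using S by (auto simp: E_cf_def)

lemma S_not_cf_ge: "\<delta> \<in> S \<Longrightarrow> \<not> cf_ge \<delta> \<rho>"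
  using S cf_eq_not_cf_ge[OF \<rho> _ \<theta>\<rho>] by (auto simp: E_cf_def)

lemma not_lepoll_nat: "\<not> {..<\<rho>} \<lesssim> (UNIV :: nat set)"
  using uncountable_\<rho> countable_lepoll[OF countableI_type[of "UNIV :: nat set"]] by metis

text \<open>The traces of the \<open>D i\<close> are clubs in \<open>\<gamma>\<close>, whose
  cofinality exceeds both the size of \<open>I\<close> and omega; so \<open>club_INT\<close> applies
  inside \<open>\<gamma>\<close>.\<close>

lemma cf_ge_club_Inter:
  assumes \<gamma>: "\<gamma> \<in> E_cf_ge \<rho>" and I: "\<not> {..<\<rho>} \<lesssim> I"
    and D: "\<And>i. i \<in> I \<Longrightarrow> club_in UNIV (D i)" "\<And>i. i \<in> I \<Longrightarrow> \<gamma> \<in> limp (D i)"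
  shows "\<gamma> \<in> limp (\<Inter>i\<in>I. D i)"
proof -
  have lim: "lim_ord \<gamma>" and cf: "cf_ge \<gamma> \<rho>" using \<gamma> by (auto simp: E_cf_ge_def)
  have "club_in {..<\<gamma>} ({..<\<gamma>} \<inter> (\<Inter>i\<in>I. D i \<inter> {..<\<gamma>}))"
  proof (rule club_INT)
    show "\<exists>b\<in>{..<\<gamma>}. \<forall>n. f n < b" if "\<And>n. f n \<in> {..<\<gamma>}" for f :: "nat \<Rightarrow> 'a"
      using cf_ge_bdd[OF \<rho> lim cf not_lepoll_nat, of f] that by auto
    show "\<exists>b\<in>{..<\<gamma>}. \<forall>i\<in>I. f i < b" if "\<And>i. i \<in> I \<Longrightarrow> f i \<in> {..<\<gamma>}" for f
      using cf_ge_bdd[OF \<rho> lim cf I, of f] that by auto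
    show "club_in {..<\<gamma>} (D i \<inter> {..<\<gamma>})" if i: "i \<in> I" for i
      unfolding club_in_def
    proof (intro conjI ballI impI)
      fix x assume "x \<in> {..<\<gamma>}"
      then show "\<exists>c\<in>D i \<inter> {..<\<gamma>}. x \<le> c" using D(2)[OF i] by (auto simp: limp_def)
    next
      fix \<beta> assume \<beta>: "\<beta> \<in> {..<\<gamma>}"
        "lim_ord \<beta> \<and> (\<forall>x<\<beta>. \<exists>c\<in>D i \<inter> {..<\<gamma>}. x \<le> c \<and> c < \<beta>)"
      then have "\<beta> \<in> limp (D i)" by (auto simp: limp_def)
      then show "\<beta> \<in> D i \<inter> {..<\<gamma>}" using D(1)[OF i] \<beta> by (auto simp: club_UNIV_iff)
    qed simp
  qed auto
  then have "\<forall>x\<in>{..<\<gamma>}. \<exists>c\<in>{..<\<gamma>} \<inter> (\<Inter>i\<in>I. D i \<inter> {..<\<gamma>}). x \<le> c"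
    unfolding club_in_def by (elim conjE)
  then show ?thesis by (intro limpI[OF lim]) blast
qed

text \<open>\<open>\<gamma>\<close> is the least ordinal such that \<open>C\<close> has at least
  \<open>\<rho>\<close> points strictly between \<open>x\<close> and \<open>\<gamma>\<close>. Were
  its cofinality smaller, these points would form a union of fewer than \<open>\<rho>\<close> sets
  \<open>C \<inter> {x<..y}\<close>, each of size less than \<open>\<rho>\<close>.\<close>

lemma E_cf_ge_meets_club:
  assumes C: "club_in UNIV (C :: 'a set)"
  obtains \<gamma> where "\<gamma> \<in> C" "\<gamma> \<in> E_cf_ge \<rho>" "x < \<gamma>"
proof -
  have "\<forall>y. \<exists>c\<in>C \<inter> {x<..}. y \<le> c"
    using club_Int[OF C club_greaterThan] by (simp add: club_UNIV_iff)
  then have "(UNIV :: 'a set) \<lesssim> C \<inter> {x<..}" using kappa unfolding is_kappa_def by blast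
  then have "{..<\<rho>} \<lesssim> C \<inter> {x<..}" using lepoll_trans subset_imp_lepoll subset_UNIV by meson
  then obtain g where g: "inj_on g {..<\<rho>}" "g ` {..<\<rho>} \<subseteq> C \<inter> {x<..}"
    unfolding lepoll_def by blast
  obtain b where b: "\<forall>i\<in>{..<\<rho>}. g i < b" using small_bdd[OF not_lepoll_initial] by blast
  define P where "P \<gamma> \<longleftrightarrow> \<not> rbdd \<rho> (C \<inter> {x<..<\<gamma>})" for \<gamma>
  have "{..<\<rho>} \<lesssim> C \<inter> {x<..<b}" unfolding lepoll_def using g b by (intro exI[of _ g]) auto
  then have "P b" unfolding P_def using not_rbdd_self[OF \<rho>] rbdd_lepoll[OF \<rho>] by blast
  define \<gamma> where "\<gamma> = (LEAST \<gamma>. P \<gamma>)"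
  have P\<gamma>: "P \<gamma>" unfolding \<gamma>_def using \<open>P b\<close> by (rule LeastI)
  have below: "rbdd \<rho> (C \<inter> {x<..y})" if "y < \<gamma>" for y
  proof -
    have "rbdd \<rho> (C \<inter> {x<..<y})"
      using not_less_Least[of y P] that unfolding \<gamma>_def P_def by blast
    then have "rbdd \<rho> (insert y (C \<inter> {x<..<y}))" by (rule rbdd_insert[OF \<rho>])
    then show ?thesis by (rule rbdd_subset[OF \<rho>]) auto
  qed
  have nonsub: "\<not> C \<inter> {x<..<\<gamma>} \<subseteq> C \<inter> {x<..y}" if "y < \<gamma>" for y
    using P\<gamma> below[OF that] rbdd_subset[OF \<rho>] unfolding P_def by blast
  have gt: "\<exists>c\<in>C. y < c \<and> c < \<gamma>" if "y < \<gamma>" for y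
  proof -
    obtain c where "c \<in> C" "x < c" "c < \<gamma>" "\<not> c \<le> y" using nonsub[OF \<open>y < \<gamma>\<close>] by fastforce
    then show ?thesis by (intro bexI[of _ c]) auto
  qed
  have "C \<inter> {x<..<\<gamma>} \<noteq> {}"
  proof
    assume "C \<inter> {x<..<\<gamma>} = {}"
    then show False using P\<gamma> rbdd_finite[OF \<rho>, of "{} :: 'a set"] unfolding P_def by simp
  qed
  then have "x < \<gamma>" by auto
  have lim: "lim_ord \<gamma>" unfolding lim_ord_def using gt \<open>x < \<gamma>\<close> by blast
  have "\<gamma> \<in> limp C" by (rule limpI[OF lim]) (use gt less_imp_le in blast)
  then have "\<gamma> \<in> C" using C by (auto simp: club_UNIV_iff)
  moreover have "cf_ge \<gamma> \<rho>"
    unfolding cf_ge_def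
  proof (intro allI impI, rule ccontr)
    fix X assume X: "cofinal_in X \<gamma>" "\<not> {..<\<rho>} \<lesssim> X"
    have "rbdd \<rho> (\<Union>y\<in>X. C \<inter> {x<..y})"
      by (rule rbdd_UN[OF \<rho> rbdd_small[OF \<rho> X(2)]]) (use X below in \<open>auto simp: cofinal_in_def\<close>)
    moreover have "C \<inter> {x<..<\<gamma>} \<subseteq> (\<Union>y\<in>X. C \<inter> {x<..y})"
      using X(1) unfolding cofinal_in_def by force
    ultimately show False using P\<gamma> rbdd_subset[OF \<rho>] unfolding P_def by blast
  qed
  ultimately show thesis using that lim \<open>x < \<gamma>\<close> by (simp add: E_cf_ge_def)
qed

text \<open>Points of \<open>D\<close> that are not limits of \<open>D\<close> have large
  cofinality, so a descent through \<open>D\<close> can only get stuck at a point of cofinality at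
  least \<open>\<rho>\<close>.\<close>

definition nice :: "'a set \<Rightarrow> bool" where
  "nice D \<longleftrightarrow> club_in UNIV D \<and> D \<subseteq> E_cf_ge \<rho> \<union> limp D"

text \<open>Keep the points of \<open>C\<close> of cofinality at least \<open>\<rho>\<close> and add
  their limits; \<open>limp_limp\<close> gives closedness.\<close>

lemma nice_refinement:
  assumes C: "club_in UNIV C"
  obtains D where "nice D" "D \<subseteq> C"
proof
  define D where "D = (C \<inter> E_cf_ge \<rho>) \<union> limp (C \<inter> E_cf_ge \<rho>)"
  have "limp D \<subseteq> limp (C \<inter> E_cf_ge \<rho>)" unfolding D_def by (rule limp_limp)
  moreover have "\<exists>c\<in>D. x \<le> c" for x
  proof -
    obtain \<gamma> where "\<gamma> \<in> C" "\<gamma> \<in> E_cf_ge \<rho>" "x < \<gamma>" using E_cf_ge_meets_club[OF C] .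
    then show ?thesis unfolding D_def by (intro bexI[of _ \<gamma>]) auto
  qed
  moreover have "limp (C \<inter> E_cf_ge \<rho>) \<subseteq> limp D" by (rule limp_mono) (auto simp: D_def)
  ultimately show "nice D" unfolding nice_def club_UNIV_iff by (auto simp: D_def)
  show "D \<subseteq> C"
    using C limp_mono[of "C \<inter> E_cf_ge \<rho>" C] unfolding D_def club_UNIV_iff by blast
qed

section \<open>Rounding down into a club and walking along ladders\<close>

text \<open>The supremum of the part of \<open>D\<close> up to \<open>\<epsilon>\<close>. For a club
  \<open>D\<close> this is the last element not above \<open>\<epsilon>\<close>, or the least
  ordinal if there is none. As a \<open>LEAST\<close> it is total and monotone in \<open>D\<close>
  without case distinctions.\<close>

definition descend :: "'a set \<Rightarrow> 'a \<Rightarrow> 'a" where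
  "descend D \<epsilon> = (LEAST u. \<forall>x\<in>D. x \<le> \<epsilon> \<longrightarrow> x \<le> u)"

lemma descend_le: "descend D \<epsilon> \<le> \<epsilon>"
  unfolding descend_def by (rule Least_le) blast

lemma descend_upper: "x \<in> D \<Longrightarrow> x \<le> \<epsilon> \<Longrightarrow> x \<le> descend D \<epsilon>"
  unfolding descend_def using LeastI[of "\<lambda>u. \<forall>x\<in>D. x \<le> \<epsilon> \<longrightarrow> x \<le> u" \<epsilon>] by blast

lemma descend_least: "(\<And>x. x \<in> D \<Longrightarrow> x \<le> \<epsilon> \<Longrightarrow> x \<le> u) \<Longrightarrow> descend D \<epsilon> \<le> u"
  unfolding descend_def by (rule Least_le) blast

lemma descend_mono: "D' \<subseteq> D \<Longrightarrow> descend D' \<epsilon> \<le> descend D \<epsilon>"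
  by (rule descend_least) (auto intro: descend_upper)

text \<open>A supremum missing from \<open>D\<close> would be a limit of \<open>D\<close>. Either
  disjunct excludes the default value: when \<open>D\<close> has no element up to
  \<open>\<epsilon>\<close>, the least ordinal results, and that is no limit.\<close>

lemma descend_in:
  assumes D: "club_in UNIV D" and lim: "lim_ord (descend D \<epsilon>) \<or> D \<inter> {..\<epsilon>} \<noteq> {}"
  shows "descend D \<epsilon> \<in> D"
proof (rule ccontr)
  assume notin: "descend D \<epsilon> \<notin> D"
  define d where "d = descend D \<epsilon>"
  have gap: "\<exists>c\<in>D. y < c \<and> c < d" if y: "y < d" for y
  proof (rule ccontr)
    assume no: "\<not> ?thesis"
    have "d \<le> y" unfolding d_def
    proof (rule descend_least)
      fix x assume "x \<in> D" "x \<le> \<epsilon>"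
      then have "x \<le> d" "x \<noteq> d" using descend_upper notin by (auto simp: d_def)
      then show "x \<le> y" using no \<open>x \<in> D\<close> by auto
    qed
    with y show False by simp
  qed
  have "lim_ord d"
  proof (cases "lim_ord d")
    case False
    then obtain x where "x \<in> D" "x \<le> \<epsilon>" using lim by (auto simp: d_def)
    then have "x < d" using descend_upper notin by (metis d_def order_le_imp_less_or_eq)
    then show ?thesis unfolding lim_ord_def using gap by blast
  qed
  then have "d \<in> limp D" by (rule limpI) (use gap less_imp_le in blast)
  then show False using D notin by (auto simp: club_UNIV_iff d_def)
qed

text \<open>Walking down from \<open>\<delta>\<close> along short ladders and rounding every step down into
  \<open>D\<close>, one can only stop at a point of cofinality at least \<open>\<rho>\<close>. Fewer than \<open>\<rho>\<close> points are
  visited, and shrinking \<open>D\<close> only lowers the rounded points, so along a decreasing sequence of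
  \<open>\<rho>\<close> clubs the tree of visited points is eventually constant.\<close>

definition ladder :: "'a \<Rightarrow> 'a set" where
  "ladder \<alpha> = (SOME C. cofinal_in C \<alpha> \<and> \<not> {..<\<rho>} \<lesssim> C)"

lemma ladder:
  assumes "\<not> cf_ge \<alpha> \<rho>"
  shows "cofinal_in (ladder \<alpha>) \<alpha>" "rbdd \<rho> (ladder \<alpha>)"
proof -
  have "\<exists>C. cofinal_in C \<alpha> \<and> \<not> {..<\<rho>} \<lesssim> C" using assms unfolding cf_ge_def by blast
  then have "cofinal_in (ladder \<alpha>) \<alpha> \<and> \<not> {..<\<rho>} \<lesssim> ladder \<alpha>" unfolding ladder_def by (rule someI_ex)
  then show "cofinal_in (ladder \<alpha>) \<alpha>" "rbdd \<rho> (ladder \<alpha>)" using rbdd_small[OF \<rho>] by blast+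
qed

text \<open>Points of cofinality at least \<open>\<rho>\<close> contribute nothing and are the
  leaves of the walk. Every other ordinal, successors included, has a ladder of size less than
  \<open>\<rho>\<close>.\<close>

definition rungs :: "'a set \<Rightarrow> 'a set" where
  "rungs A = (\<Union>\<alpha>\<in>{\<alpha>\<in>A. \<not> cf_ge \<alpha> \<rho>}. ladder \<alpha>)"

primrec level :: "'a set \<Rightarrow> 'a \<Rightarrow> nat \<Rightarrow> 'a set" where
  "level D \<delta> 0 = {\<delta>}"
| "level D \<delta> (Suc n) = descend D ` rungs (level D \<delta> n)"

definition tree :: "'a set \<Rightarrow> 'a \<Rightarrow> 'a set" where
  "tree D \<delta> = (\<Union>n. level D \<delta> n)"

lemma rbdd_rungs: "rbdd \<rho> A \<Longrightarrow> rbdd \<rho> (rungs A)"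
  unfolding rungs_def
  by (intro rbdd_UN[OF \<rho>]) (auto intro: rbdd_subset[OF \<rho>] ladder)

lemma rbdd_level: "rbdd \<rho> (level D \<delta> n)"
  by (induction n) (simp_all add: rbdd_finite[OF \<rho>] rbdd_image[OF \<rho>] rbdd_rungs)

lemma tree_root: "\<delta> \<in> tree D \<delta>"
  unfolding tree_def by (rule UN_I[of 0]) auto

lemma tree_step:
  assumes "\<alpha> \<in> tree D \<delta>" "\<not> cf_ge \<alpha> \<rho>" "\<epsilon> \<in> ladder \<alpha>"
  shows "descend D \<epsilon> \<in> tree D \<delta>"
proof -
  obtain n where "\<alpha> \<in> level D \<delta> n" using assms unfolding tree_def by blast
  then have "descend D \<epsilon> \<in> level D \<delta> (Suc n)" using assms by (auto simp: rungs_def)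
  then show ?thesis unfolding tree_def by blast
qed

lemma level_le: "\<alpha> \<in> level D \<delta> n \<Longrightarrow> \<alpha> \<le> \<delta>"
proof (induction n arbitrary: \<alpha>)
  case (Suc n)
  then obtain \<beta> \<epsilon> where "\<beta> \<in> level D \<delta> n" "\<not> cf_ge \<beta> \<rho>" "\<epsilon> \<in> ladder \<beta>" "\<alpha> = descend D \<epsilon>"
    by (auto simp: rungs_def)
  then show ?case
    using Suc.IH[of \<beta>] ladder(1)[of \<beta>] descend_le[of D \<epsilon>] by (force simp: cofinal_in_def)
qed simp

text \<open>Such an \<open>\<alpha>\<close> is not the root, hence is a value of
  \<open>descend D\<close>; being a limit, it falls under \<open>descend_in\<close>.\<close>

lemma tree_E_cf_ge_in:
  assumes D: "club_in UNIV D" and \<delta>: "\<not> cf_ge \<delta> \<rho>" and \<alpha>: "\<alpha> \<in> tree D \<delta>" "\<alpha> \<in> E_cf_ge \<rho>"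
  shows "\<alpha> \<in> D" "\<alpha> < \<delta>"
proof -
  obtain n where n: "\<alpha> \<in> level D \<delta> n" using \<alpha> unfolding tree_def by blast
  have "\<alpha> \<noteq> \<delta>" using \<alpha> \<delta> by (auto simp: E_cf_ge_def)
  then show "\<alpha> < \<delta>" using level_le[OF n] by simp
  obtain m where "n = Suc m" using n \<open>\<alpha> \<noteq> \<delta>\<close> by (cases n) auto
  then obtain \<epsilon> where "\<alpha> = descend D \<epsilon>" using n by auto
  then show "\<alpha> \<in> D" using descend_in[OF D] \<alpha> by (auto simp: E_cf_ge_def)
qed

text \<open>Take the least node in \<open>D\<close> above \<open>\<eta>\<close>. If its cofinality
  were small, it would be a limit of \<open>D\<close> because \<open>D\<close> is
  \<open>nice\<close>, and one more step of the walk would give a smaller such node.\<close>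

lemma tree_cofinal:
  assumes D: "nice D" and \<delta>: "\<not> cf_ge \<delta> \<rho>" "\<delta> \<in> limp D" and "\<eta> < \<delta>"
  shows "\<exists>\<beta>\<in>tree D \<delta> \<inter> E_cf_ge \<rho>. \<eta> \<le> \<beta>"
proof -
  have club: "club_in UNIV D" using D by (simp add: nice_def)
  define P where "P \<alpha> \<longleftrightarrow> \<alpha> \<in> tree D \<delta> \<and> \<eta> < \<alpha> \<and> \<alpha> \<in> D" for \<alpha>
  have "\<delta> \<in> D" using \<delta> club by (auto simp: club_UNIV_iff)
  then have "P \<delta>" using tree_root \<open>\<eta> < \<delta>\<close> by (simp add: P_def)
  define \<alpha> where "\<alpha> = (LEAST \<alpha>. P \<alpha>)"
  have P\<alpha>: "P \<alpha>" unfolding \<alpha>_def using \<open>P \<delta>\<close> by (rule LeastI)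
  have "\<alpha> \<in> E_cf_ge \<rho>"
  proof (rule ccontr)
    assume no: "\<alpha> \<notin> E_cf_ge \<rho>"
    then have lim: "\<alpha> \<in> limp D" using D P\<alpha> by (auto simp: nice_def P_def)
    then have cf: "\<not> cf_ge \<alpha> \<rho>" using no by (auto simp: E_cf_ge_def limp_def)
    obtain c where c: "c \<in> D" "\<eta> < c" "c < \<alpha>" using limp_strict[OF lim] P\<alpha> by (auto simp: P_def)
    \<comment> \<open>A rung above an element \<open>c\<close> of \<open>D\<close> with
      \<open>\<eta> < c\<close> cannot be rounded down below \<open>c\<close>, so the next node
      stays above \<open>\<eta>\<close>.\<close>
    obtain \<epsilon> where \<epsilon>: "\<epsilon> \<in> ladder \<alpha>" "c \<le> \<epsilon>" "\<epsilon> < \<alpha>"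
      using ladder(1)[OF cf] c unfolding cofinal_in_def by blast
    have "descend D \<epsilon> \<in> D" using descend_in[OF club] c \<epsilon> by auto
    moreover have "\<eta> < descend D \<epsilon>" using descend_upper[OF c(1) \<epsilon>(2)] c by simp
    moreover have "descend D \<epsilon> < \<alpha>" using descend_le \<epsilon>(3) by (rule order_le_less_trans)
    moreover have "descend D \<epsilon> \<in> tree D \<delta>" using tree_step[OF _ cf \<epsilon>(1)] P\<alpha> by (simp add: P_def)
    ultimately show False using not_less_Least[of "descend D \<epsilon>" P] unfolding \<alpha>_def P_def by blast
  qed
  with P\<alpha> show ?thesis by (intro bexI[of _ \<alpha>]) (auto simp: P_def)
qed

text \<open>Each rounded point decreases with \<open>j\<close> and so stabilises before
  \<open>\<rho>\<close>. One level has fewer than \<open>\<rho>\<close> rungs, so regularity bounds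
  their stabilisation indices; the countably many levels are bounded in the same way.\<close>

lemma tree_stable:
  assumes D: "\<And>i j. i \<le> j \<Longrightarrow> D j \<subseteq> D (i::'a)"
  shows "\<exists>m<\<rho>. \<forall>j. m \<le> j \<longrightarrow> j < \<rho> \<longrightarrow> tree (D j) \<delta> = tree (D m) \<delta>"
proof -
  obtain i0 where i0: "i0 < \<rho>" using regular_lim_ord[OF \<rho>] by (auto simp: lim_ord_def)
  have "\<exists>m<\<rho>. \<forall>j. m \<le> j \<and> j < \<rho> \<longrightarrow> descend (D j) \<epsilon> = descend (D m) \<epsilon>" for \<epsilon>
    using eventually_constant[of \<rho> "\<lambda>j. descend (D j) \<epsilon>", OF descend_mono i0] D by blast
  then obtain m where m: "\<And>\<epsilon>. m \<epsilon> < \<rho>"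
    "\<And>\<epsilon> j. m \<epsilon> \<le> j \<Longrightarrow> j < \<rho> \<Longrightarrow> descend (D j) \<epsilon> = descend (D (m \<epsilon>)) \<epsilon>" by metis
  have "\<exists>b<\<rho>. \<forall>j. b \<le> j \<and> j < \<rho> \<longrightarrow> level (D j) \<delta> n = level (D b) \<delta> n" for n
  proof (induction n)
    case 0
    then show ?case using i0 by auto
  next
    case (Suc n)
    then obtain b where b: "b < \<rho>" "\<And>j. b \<le> j \<Longrightarrow> j < \<rho> \<Longrightarrow> level (D j) \<delta> n = level (D b) \<delta> n"
      by blast
    let ?W = "rungs (level (D b) \<delta> n)"
    have "\<exists>c<\<rho>. \<forall>\<epsilon>\<in>?W. m \<epsilon> \<le> c"
      by (rule rbddD[OF rbdd_rungs[OF rbdd_level]]) (rule m(1))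
    then obtain c where c: "c < \<rho>" "\<And>\<epsilon>. \<epsilon> \<in> ?W \<Longrightarrow> m \<epsilon> \<le> c" by blast
    have lev: "level (D j) \<delta> (Suc n) = (\<lambda>\<epsilon>. descend (D (m \<epsilon>)) \<epsilon>) ` ?W" if "max b c \<le> j" "j < \<rho>" for j
    proof -
      have "descend (D j) \<epsilon> = descend (D (m \<epsilon>)) \<epsilon>" if "\<epsilon> \<in> ?W" for \<epsilon>
        using m(2) c(2)[OF that] \<open>max b c \<le> j\<close> \<open>j < \<rho>\<close> by (meson max.boundedE order_trans)
      then have "descend (D j) ` ?W = (\<lambda>\<epsilon>. descend (D (m \<epsilon>)) \<epsilon>) ` ?W" by (rule image_cong[OF refl])
      then show ?thesis using b(2)[of j] that by simp
    qed
    have less: "max b c < \<rho>" using b(1) c(1) by simp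
    have "level (D j) \<delta> (Suc n) = level (D (max b c)) \<delta> (Suc n)" if "max b c \<le> j" "j < \<rho>" for j
      using lev[OF that] lev[OF order_refl less] by (rule trans[OF _ sym])
    with less show ?case by blast
  qed
  then obtain b where b: "\<And>n. b n < \<rho>"
    "\<And>n j. b n \<le> j \<Longrightarrow> j < \<rho> \<Longrightarrow> level (D j) \<delta> n = level (D (b n)) \<delta> n" by metis
  have "\<exists>c<\<rho>. \<forall>n\<in>UNIV. b n \<le> c"
    by (rule rbddD[OF rbdd_small[OF \<rho> not_lepoll_nat]]) (rule b(1))
  then obtain c where c: "c < \<rho>" "\<And>n. b n \<le> c" by blast
  show ?thesis
  proof (intro exI[of _ c] conjI allI impI c(1))
    fix j assume j: "c \<le> j" "j < \<rho>"
    have "level (D j) \<delta> n = level (D c) \<delta> n" for n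
      using b(2)[of n j] b(2)[of n c] c j by (metis order_trans)
    then show "tree (D j) \<delta> = tree (D c) \<delta>" unfolding tree_def by simp
  qed
qed

section \<open>Guessing clubs stationarily often\<close>

definition good :: "'a \<Rightarrow> 'a set \<Rightarrow> 'a set \<Rightarrow> bool" where
  "good \<delta> B D \<longleftrightarrow> B \<subseteq> {..<\<delta>} \<inter> E_cf_ge \<rho> \<and> (\<forall>x<\<delta>. \<exists>c\<in>B. x \<le> c) \<and>
     (\<exists>\<eta><\<delta>. \<forall>x\<in>B. \<eta> < x \<longrightarrow> x \<in> D)"

lemma good_mono: "good \<delta> B D \<Longrightarrow> D \<subseteq> D' \<Longrightarrow> good \<delta> B D'"
  unfolding good_def by blast

text \<open>If the leaves of the trees of every \<open>D\<close> fail to guess, let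
  \<open>h D\<close> be a club witnessing this, and iterate. At a \<open>\<delta>\<close> in
  \<open>T\<close> that is a limit of the first \<open>\<rho>\<close> clubs, the tree is stable from
  some \<open>m\<close> on, so its leaves lie in a later club and hence in \<open>h (D m)\<close>, a
  contradiction.\<close>

lemma club_guessing:
  assumes T: "T \<subseteq> S" "stat T"
  shows "\<exists>B. \<forall>D. club_in UNIV D \<longrightarrow> stat {\<delta>\<in>T. good \<delta> (B \<delta>) D}"
proof (rule ccontr)
  assume no: "\<not> ?thesis"
  define B where "B D \<delta> = tree D \<delta> \<inter> E_cf_ge \<rho>" for D \<delta>
  have "\<exists>E. club_in UNIV E \<and> (\<forall>\<delta>\<in>T \<inter> E. \<not> good \<delta> (B D \<delta>) E)" for D
  proof -
    obtain D' where D': "club_in UNIV D'" "\<not> stat {\<delta>\<in>T. good \<delta> (B D \<delta>) D'}"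
      using no by blast
    obtain E where E: "club_in UNIV E" "{\<delta>\<in>T. good \<delta> (B D \<delta>) D'} \<inter> E = {}"
      using not_statE[OF D'(2)] .
    \<comment> \<open>Intersecting makes one club serve both as the target that is missed and as the
      set of places where it is missed.\<close>
    have "club_in UNIV (D' \<inter> E)" using D' E club_Int by blast
    moreover have "\<not> good \<delta> (B D \<delta>) (D' \<inter> E)" if "\<delta> \<in> T \<inter> (D' \<inter> E)" for \<delta>
      using E(2) that good_mono[of \<delta> "B D \<delta>" "D' \<inter> E" D'] by blast
    ultimately show ?thesis by blast
  qed
  then obtain h where h: "\<And>D. club_in UNIV (h D)"
    "\<And>D \<delta>. \<delta> \<in> T \<Longrightarrow> \<delta> \<in> h D \<Longrightarrow> \<not> good \<delta> (B D \<delta>) (h D)" by (metis IntI)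
  have "\<exists>f. \<forall>i::'a. nice (f i) \<and> (\<forall>j<i. f i \<subseteq> f j \<inter> h (f j))"
  proof (rule dependent_wellorder_choice)
    fix i :: 'a and f assume f: "\<And>j. j < i \<Longrightarrow> nice (f j) \<and> (\<forall>k<j. f j \<subseteq> f k \<inter> h (f k))"
    have "club_in UNIV (\<Inter>j\<in>{..<i}. f j \<inter> h (f j))"
      by (rule club_Inter[OF not_lepoll_initial]) (use f h club_Int in \<open>auto simp: nice_def\<close>)
    then obtain r where "nice r" "r \<subseteq> (\<Inter>j\<in>{..<i}. f j \<inter> h (f j))" by (rule nice_refinement)
    then show "\<exists>r. nice r \<and> (\<forall>j<i. r \<subseteq> f j \<inter> h (f j))" by blast
  qed auto
  then obtain D where D0: "\<forall>i::'a. nice (D i) \<and> (\<forall>j<i. D i \<subseteq> D j \<inter> h (D j))" ..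
  have nice: "nice (D i)" for i using D0 by blast
  have D: "D i \<subseteq> D j \<inter> h (D j)" if "j < i" for i j using D0 that by blast
  have club: "club_in UNIV (D i)" for i using nice by (simp add: nice_def)
  have "club_in UNIV (limp (\<Inter>i\<in>{..<\<rho>}. D i))"
    by (intro club_limp club_Inter[OF not_lepoll_initial] club)
  then obtain \<delta> where \<delta>: "\<delta> \<in> T" "\<delta> \<in> limp (\<Inter>i\<in>{..<\<rho>}. D i)" using statD[OF T(2)] by blast
  have lim: "\<delta> \<in> limp (D i)" if "i < \<rho>" for i
    using \<delta>(2) limp_mono[of "\<Inter>i\<in>{..<\<rho>}. D i" "D i"] that by blast
  have cf: "\<not> cf_ge \<delta> \<rho>" using S_not_cf_ge \<delta> T by blast
  have dec: "D j \<subseteq> D i" if "i \<le> j" for i j using D[of i j] that by (cases "i = j") auto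
  obtain m where m: "m < \<rho>" "\<And>j. m \<le> j \<Longrightarrow> j < \<rho> \<Longrightarrow> tree (D j) \<delta> = tree (D m) \<delta>"
    using tree_stable[of D \<delta>, OF dec] by blast
  obtain j where j: "m < j" "j < \<rho>" using m regular_lim_ord[OF \<rho>] by (auto simp: lim_ord_def)
  \<comment> \<open>Stability moves the leaves computed from \<open>D m\<close> into the later club
    \<open>D j\<close>, which is contained in \<open>h (D m)\<close>.\<close>
  have "B (D m) \<delta> = B (D j) \<delta>" unfolding B_def using m(2)[of j] j by simp
  then have sub: "B (D m) \<delta> \<subseteq> D j"
    using tree_E_cf_ge_in(1)[OF club cf] unfolding B_def by blast
  have "good \<delta> (B (D m) \<delta>) (h (D m))"
    unfolding good_def
  proof (intro conjI)
    show "B (D m) \<delta> \<subseteq> {..<\<delta>} \<inter> E_cf_ge \<rho>"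
      using tree_E_cf_ge_in(2)[OF club cf] unfolding B_def by blast
    show "\<forall>x<\<delta>. \<exists>c\<in>B (D m) \<delta>. x \<le> c"
      using tree_cofinal[OF nice cf lim[OF m(1)]] unfolding B_def by blast
    \<comment> \<open>All the leaves lie in \<open>h (D m)\<close>, so any bound below
      \<open>\<delta>\<close> will do.\<close>
    obtain \<eta> where "\<eta> < \<delta>" using lim[OF m(1)] by (auto simp: limp_def lim_ord_def)
    then show "\<exists>\<eta><\<delta>. \<forall>x\<in>B (D m) \<delta>. \<eta> < x \<longrightarrow> x \<in> h (D m)"
      using sub D[OF j(1)] by blast
  qed
  moreover have "\<delta> \<in> h (D m)"
    using lim[OF j(2)] club[of j] D[OF j(1)] by (auto simp: club_UNIV_iff)
  ultimately show False using h(2) \<delta>(1) by blast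
qed

subsection \<open>Towers of length $\kappa^+$\<close>

text \<open>The cardinal successor of kappa is realised as a well-order on \<open>'a set\<close>,
  which is the index type of the towers.\<close>

lemma kplus_length: "has_length_kplus TYPE('a) (cardSuc (card_of (UNIV :: 'a set)))"
proof -
  let ?u = "card_of (UNIV :: 'a set)" and ?w = "cardSuc (card_of (UNIV :: 'a set))"
  have card: "Card_order ?u" "Card_order ?w" by (simp_all add: card_of_Card_order cardSuc_Card_order)
  have "\<not> Field ?w \<lesssim> (UNIV :: 'a set)"
  proof
    assume "Field ?w \<lesssim> (UNIV :: 'a set)"
    then have "(card_of (Field ?w), ?u) \<in> ordLeq" unfolding lepoll_def using card_of_ordLeq by blast
    then have "(?w, ?u) \<in> ordLeq"
      using card_of_Field_ordIso[OF card(2)] ordIso_ordLeq_trans ordIso_symmetric by blast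
    then show False using cardSuc_greater[OF card(1)] not_ordLess_ordLeq by blast
  qed
  moreover have "underS ?w i \<lesssim> (UNIV :: 'a set)" if "i \<in> Field ?w" for i
  proof -
    have "(card_of (underS ?w i), ?w) \<in> ordLess" using card_of_underS[OF card(2) that] .
    then have "(card_of (underS ?w i), ?u) \<in> ordLeq"
      using cardSuc_ordLeq_ordLess[OF card(1) card_of_Card_order] by blast
    then show ?thesis unfolding lepoll_def using card_of_ordLeq by blast
  qed
  ultimately show ?thesis
    unfolding has_length_kplus_def using card(2) by (auto simp: card_order_on_def)
qed

definition kplus_tower :: bool where
  "kplus_tower \<longleftrightarrow> (\<exists>(w :: 'a set rel) A. has_length_kplus TYPE('a) w \<and>
              asc_tower (NS_restr S) bounded_ideal w A)"

text \<open>Recursion along the successor cardinal: each stage has at most kappa predecessors, so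
  they can be listed as a family \<open>F\<close> indexed by \<open>'a\<close>, and
  \<open>step\<close> supplies the next set.\<close>

lemma kplus_towerI:
  assumes P: "p0 \<in> P" "\<And>X. X \<in> P \<Longrightarrow> X \<subseteq> S"
    and step: "\<And>F :: 'a \<Rightarrow> 'a set. (\<And>x. F x \<in> P) \<Longrightarrow>
      \<exists>Y\<in>P. \<forall>x. F x - Y \<in> bounded_ideal \<and> stat (Y - F x)"
  shows kplus_tower
proof -
  let ?w = "cardSuc (card_of (UNIV :: 'a set))"
  have len: "has_length_kplus TYPE('a) ?w" by (rule kplus_length)
  then have wo: "Well_order ?w" by (simp add: has_length_kplus_def)
  have wf: "wf (?w - Id)" using wo by (simp add: well_order_on_def)
  \<comment> \<open>\<open>stat r\<close> is carried along so that every member of the tower, the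
    first included, is positive.\<close>
  define Q where "Q f j r \<longleftrightarrow> (j \<in> Field ?w \<longrightarrow> r \<in> P \<and> stat r \<and>
    (\<forall>i\<in>underS ?w j. f i - r \<in> bounded_ideal \<and> stat (r - f i)))" for f :: "'a set \<Rightarrow> 'a set" and j r
  have "\<exists>f. \<forall>j. Q f j (f j)"
  proof (rule dependent_wf_choice[OF wf])
    fix f g :: "'a set \<Rightarrow> 'a set" and j r assume eq: "\<And>z. (z, j) \<in> ?w - Id \<Longrightarrow> f z = g z"
    have "f i = g i" if "i \<in> underS ?w j" for i
      by (rule eq) (use that in \<open>auto simp: underS_def\<close>)
    then show "Q f j r = Q g j r" unfolding Q_def by simp
  next
    fix j and f :: "'a set \<Rightarrow> 'a set" assume IH: "\<And>i. (i, j) \<in> ?w - Id \<Longrightarrow> Q f i (f i)"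
    show "\<exists>r. Q f j r"
    proof (cases "j \<in> Field ?w")
      case True
      have "underS ?w j \<lesssim> (UNIV :: 'a set)" using len True unfolding has_length_kplus_def by blast
      then obtain h :: "'a set \<Rightarrow> 'a" where h: "inj_on h (underS ?w j)" unfolding lepoll_def by blast
      \<comment> \<open>Places of \<open>'a\<close> outside the range of \<open>h\<close> are filled
        with \<open>p0\<close>; this only asks \<open>Y\<close> to lie above one more set.\<close>
      define F where "F x = (if x \<in> h ` underS ?w j then f (inv_into (underS ?w j) h x) else p0)" for x
      have fP: "f i \<in> P" if "i \<in> underS ?w j" for i
      proof -
        have "(i, j) \<in> ?w - Id" using that by (auto simp: underS_def)
        then show ?thesis using IH[of i] FieldI1[of i j ?w] by (auto simp: Q_def)
      qed
      have "F x \<in> P" for x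
        unfolding F_def using P(1) fP inv_into_into[of x h "underS ?w j"] by auto
      then obtain Y where Y: "Y \<in> P" "\<And>x. F x - Y \<in> bounded_ideal" "\<And>x. stat (Y - F x)"
        using step[of F] by blast
      have "F (h i) = f i" if "i \<in> underS ?w j" for i
        unfolding F_def using that inv_into_f_f[OF h that] by simp
      then have "f i - Y \<in> bounded_ideal \<and> stat (Y - f i)" if "i \<in> underS ?w j" for i
        using Y(2)[of "h i"] Y(3)[of "h i"] that by simp
      moreover have "stat Y" using stat_mono[OF Y(3)[of undefined]] by blast
      ultimately have "Q f j Y" using Y(1) unfolding Q_def by blast
      then show ?thesis by blast
    qed (simp add: Q_def)
  qed
  then obtain A where A: "\<forall>j. Q A j (A j)" ..
  have AP: "A i \<subseteq> S" "stat (A i)" if "i \<in> Field ?w" for i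
    using A P(2) that unfolding Q_def by blast+
  have "asc_tower (NS_restr S) bounded_ideal ?w A"
    unfolding asc_tower_def
  proof (intro conjI ballI allI impI)
    fix i assume "i \<in> Field ?w"
    then show "A i \<notin> NS_restr S" using AP[of i] by (simp add: NS_restr_def Int_absorb2)
  next
    fix i j assume ij: "(i, j) \<in> ?w \<and> i \<noteq> j"
    then have F: "i \<in> Field ?w" "j \<in> Field ?w" and u: "i \<in> underS ?w j"
      by (auto simp: underS_def FieldI1 FieldI2)
    then show "A i - A j \<in> bounded_ideal" using A unfolding Q_def by blast
    have "stat (A j - A i)" using A F u unfolding Q_def by blast
    moreover have "(A j - A i) \<inter> S = A j - A i" using AP(1)[OF F(2)] by blast
    ultimately show "A j - A i \<notin> NS_restr S" by (simp add: NS_restr_def)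
  qed
  with len show ?thesis unfolding kplus_tower_def by blast
qed

section \<open>Guessing almost everywhere, and gluing\<close>

text \<open>A single \<open>B\<close>, chosen before \<open>D\<close>, succeeds at all but
  nonstationarily many points of \<open>A\<close>, whereas \<open>club_guessing\<close> only gives
  stationarily many.\<close>

definition guessable :: "'a set \<Rightarrow> bool" where
  "guessable A \<longleftrightarrow> A \<subseteq> S \<and> (\<exists>B. \<forall>D. club_in UNIV D \<longrightarrow>
     (\<exists>E. club_in UNIV E \<and> (\<forall>\<delta>\<in>A \<inter> E. good \<delta> (B \<delta>) D)))"

lemma bounded_idealI: "(\<And>y. y \<in> X \<Longrightarrow> y \<le> x) \<Longrightarrow> (X :: 'a set) \<in> bounded_ideal"
proof -
  assume X: "\<And>y. y \<in> X \<Longrightarrow> y \<le> x"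
  obtain b where "x < b" using ex_gt by blast
  then have "X \<subseteq> {..<b}" using X by (auto intro: order_le_less_trans)
  then show ?thesis unfolding bounded_ideal_def by blast
qed

lemma stat_tail: "stat T \<Longrightarrow> (\<And>y. y \<in> T \<Longrightarrow> x < y \<Longrightarrow> y \<in> U) \<Longrightarrow> stat U"
  by (rule stat_mono[OF stat_Int_club[OF _ club_greaterThan[of x]]]) auto

text \<open>The success sets \<open>A D\<close> shrink with \<open>D\<close>. If they stabilise
  modulo nonstationary sets at some \<open>D\<close>, then \<open>A D\<close> is guessable.
  Otherwise the complements \<open>T - A D\<close> grow forever, and diagonal intersections put one
  of them above any kappa many: this is a tower.\<close>

lemma guessable_dense:
  assumes T: "T \<subseteq> S" "stat T" and nt: "\<not> kplus_tower"
  shows "\<exists>U\<subseteq>T. stat U \<and> guessable U"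
proof -
  obtain B where B: "\<And>D. club_in UNIV D \<Longrightarrow> stat {\<delta>\<in>T. good \<delta> (B \<delta>) D}"
    using club_guessing[OF T] by blast
  define A where "A D = {\<delta>\<in>T. good \<delta> (B \<delta>) D}" for D
  have "\<exists>D. club_in UNIV D \<and> (\<forall>D'. club_in UNIV D' \<longrightarrow> \<not> stat (A D - A D'))"
  proof (rule ccontr)
    assume no: "\<not> ?thesis"
    have kplus_tower
    proof (rule kplus_towerI)
      show "T - A UNIV \<in> {T - A D | D. club_in UNIV D}" using club_UNIV by blast
      show "X \<subseteq> S" if "X \<in> {T - A D | D. club_in UNIV D}" for X using that T(1) by blast
      fix F :: "'a \<Rightarrow> 'a set" assume F: "\<And>x. F x \<in> {T - A D | D. club_in UNIV D}"
      have "\<forall>x. \<exists>D. F x = T - A D \<and> club_in UNIV D" using F by blast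
      then obtain D where D: "\<And>x. F x = T - A (D x)" "\<And>x. club_in UNIV (D x)" by metis
      define \<Delta> where "\<Delta> = {\<delta>. \<forall>x<\<delta>. \<delta> \<in> D x}"
      have \<Delta>: "club_in UNIV \<Delta>" unfolding \<Delta>_def using D(2) by (rule club_diag)
      then obtain D' where D': "club_in UNIV D'" "stat (A \<Delta> - A D')" using no by blast
      \<comment> \<open>Points of \<open>\<Delta>\<close> above \<open>x\<close> lie in
        \<open>D x\<close>, so it is enough to raise the exceptional bound from
        \<open>\<eta>\<close> to \<open>max \<eta> x\<close>, which is still below
        \<open>\<delta>\<close>.\<close>
      have tail: "\<delta> \<in> A (D x)" if \<delta>: "\<delta> \<in> A \<Delta>" "x < \<delta>" for \<delta> x
      proof -
        obtain \<eta> where \<eta>: "\<eta> < \<delta>" "\<forall>y\<in>B \<delta>. \<eta> < y \<longrightarrow> y \<in> \<Delta>"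
          using \<delta>(1) unfolding A_def good_def by blast
        have "\<forall>y\<in>B \<delta>. max \<eta> x < y \<longrightarrow> y \<in> D x" using \<eta>(2) unfolding \<Delta>_def by simp
        moreover have "max \<eta> x < \<delta>" using \<eta> \<delta> by simp
        ultimately show ?thesis using \<delta>(1) unfolding A_def good_def by blast
      qed
      have sub: "A (\<Delta> \<inter> D') \<subseteq> A \<Delta> \<inter> A D'" unfolding A_def using good_mono by blast
      show "\<exists>Y\<in>{T - A D | D. club_in UNIV D}. \<forall>x. F x - Y \<in> bounded_ideal \<and> stat (Y - F x)"
      proof (intro bexI[of _ "T - A (\<Delta> \<inter> D')"] allI conjI)
        fix x
        show "F x - (T - A (\<Delta> \<inter> D')) \<in> bounded_ideal"
          by (rule bounded_idealI[of _ x]) (use sub tail D(1) in \<open>auto simp: not_less[symmetric]\<close>)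
        show "stat (T - A (\<Delta> \<inter> D') - F x)"
          by (rule stat_tail[OF D'(2), of x]) (use sub tail D(1) in \<open>auto simp: A_def\<close>)
      next
        show "T - A (\<Delta> \<inter> D') \<in> {T - A D | D. club_in UNIV D}"
          using club_Int[OF \<Delta> D'(1)] by blast
      qed
    qed
    with nt show False by blast
  qed
  then obtain D where D: "club_in UNIV D" "\<And>D'. club_in UNIV D' \<Longrightarrow> \<not> stat (A D - A D')" by blast
  have "guessable (A D)"
    unfolding guessable_def
  proof (intro conjI exI[of _ B] allI impI)
    show "A D \<subseteq> S" using T by (auto simp: A_def)
    fix D' :: "'a set" assume "club_in UNIV D'"
    then obtain E where "club_in UNIV E" "(A D - A D') \<inter> E = {}" using not_statE D(2) by blast
    then show "\<exists>E. club_in UNIV E \<and> (\<forall>\<delta>\<in>A D \<inter> E. good \<delta> (B \<delta>) D')"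
      by (intro exI[of _ E]) (auto simp: A_def)
  qed
  then show ?thesis using B[OF D(1)] by (intro exI[of _ "A D"]) (auto simp: A_def)
qed

text \<open>At \<open>\<delta>\<close> use the guess belonging to a chosen index
  \<open>p \<delta>\<close> below \<open>\<delta>\<close>. The diagonal intersection of the clubs
  \<open>E x\<close> then contains only \<open>\<delta>\<close> lying in
  \<open>E (p \<delta>)\<close>, precisely because the index is smaller.\<close>

lemma guessable_diag:
  assumes F: "\<And>x::'a. guessable (F x)"
  shows "guessable {\<delta>. \<exists>x<\<delta>. \<delta> \<in> F x}"
proof -
  have "\<forall>x. \<exists>B. \<forall>D. club_in UNIV D \<longrightarrow>
     (\<exists>E. club_in UNIV E \<and> (\<forall>\<delta>\<in>F x \<inter> E. good \<delta> (B \<delta>) D))"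
    using F unfolding guessable_def by blast
  then obtain B where B: "\<forall>x D. club_in UNIV D \<longrightarrow>
     (\<exists>E. club_in UNIV E \<and> (\<forall>\<delta>\<in>F x \<inter> E. good \<delta> (B x \<delta>) D))" by metis
  define p where "p \<delta> = (SOME x. x < \<delta> \<and> \<delta> \<in> F x)" for \<delta>
  have p: "p \<delta> < \<delta> \<and> \<delta> \<in> F (p \<delta>)" if "\<delta> \<in> {\<delta>. \<exists>x<\<delta>. \<delta> \<in> F x}" for \<delta>
    unfolding p_def by (rule someI_ex) (use that in blast)
  show ?thesis
    unfolding guessable_def
  proof (intro conjI exI[of _ "\<lambda>\<delta>. B (p \<delta>) \<delta>"] allI impI)
    show "{\<delta>. \<exists>x<\<delta>. \<delta> \<in> F x} \<subseteq> S" using F unfolding guessable_def by blast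
    fix D :: "'a set" assume "club_in UNIV D"
    then have "\<forall>x. \<exists>E. club_in UNIV E \<and> (\<forall>\<delta>\<in>F x \<inter> E. good \<delta> (B x \<delta>) D)" using B by blast
    then obtain E where E: "\<And>x. club_in UNIV (E x)"
      "\<And>x \<delta>. \<delta> \<in> F x \<Longrightarrow> \<delta> \<in> E x \<Longrightarrow> good \<delta> (B x \<delta>) D" by (metis IntI)
    show "\<exists>E. club_in UNIV E \<and> (\<forall>\<delta>\<in>{\<delta>. \<exists>x<\<delta>. \<delta> \<in> F x} \<inter> E. good \<delta> (B (p \<delta>) \<delta>) D)"
      using club_diag[of E] E p by (intro exI[of _ "{\<delta>. \<forall>x<\<delta>. \<delta> \<in> E x}"]) blast
  qed
qed

lemma guessable_mod_nonstat:
  assumes "guessable A" "U \<subseteq> S" "\<not> stat (U - A)"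
  shows "guessable U"
proof -
  obtain B where B: "\<And>D. club_in UNIV D \<Longrightarrow>
     \<exists>E. club_in UNIV E \<and> (\<forall>\<delta>\<in>A \<inter> E. good \<delta> (B \<delta>) D)"
    using assms(1) unfolding guessable_def by blast
  obtain E0 where E0: "club_in UNIV E0" "(U - A) \<inter> E0 = {}" using not_statE[OF assms(3)] .
  show ?thesis
    unfolding guessable_def
  proof (intro conjI exI[of _ B] allI impI assms(2))
    fix D :: "'a set" assume "club_in UNIV D"
    then obtain E where E: "club_in UNIV E" "\<forall>\<delta>\<in>A \<inter> E. good \<delta> (B \<delta>) D" using B by blast
    have "club_in UNIV (E \<inter> E0)" using E E0 club_Int by blast
    moreover have "\<forall>\<delta>\<in>U \<inter> (E \<inter> E0). good \<delta> (B \<delta>) D" using E(2) E0(2) by blast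
    ultimately show "\<exists>E. club_in UNIV E \<and> (\<forall>\<delta>\<in>U \<inter> E. good \<delta> (B \<delta>) D)" by blast
  qed
qed

text \<open>Otherwise the guessable sets themselves yield a tower: the diagonal union
  \<open>V\<close> of kappa many of them leaves a stationary part of \<open>S\<close>, and
  \<open>guessable_dense\<close> finds in it a stationary guessable \<open>U\<close> to
  adjoin.\<close>

lemma guessable_S:
  assumes nt: "\<not> kplus_tower"
  shows "guessable S"
proof (rule ccontr)
  assume no: "\<not> guessable S"
  have kplus_tower
  proof (rule kplus_towerI)
    show "{} \<in> Collect guessable"
      unfolding guessable_def using club_UNIV by blast
    show "X \<subseteq> S" if "X \<in> Collect guessable" for X using that unfolding guessable_def by blast
    fix F :: "'a \<Rightarrow> 'a set" assume F: "\<And>x. F x \<in> Collect guessable"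
    define V where "V = {\<delta>. \<exists>x<\<delta>. \<delta> \<in> F x}"
    have V: "guessable V" unfolding V_def by (rule guessable_diag) (use F in blast)
    have "stat (S - V)" using guessable_mod_nonstat[OF V order_refl] no by blast
    then obtain U where U: "U \<subseteq> S - V" "stat U" "guessable U"
      using guessable_dense[OF _ _ nt, of "S - V"] by blast
    \<comment> \<open>Two indices suffice to form \<open>U \<union> V\<close> as a diagonal union,
      up to a bounded set: \<open>a\<close> contributes \<open>U\<close> and \<open>b\<close>
      contributes \<open>V\<close>. Thus \<open>guessable_diag\<close> applies once more.\<close>
    obtain a b :: 'a where ab: "a < b" using ex_gt by blast
    define G where "G x = (if x = a then U else V)" for x
    define Y where "Y = {\<delta>. \<exists>x<\<delta>. \<delta> \<in> G x}"
    have Y: "guessable Y" unfolding Y_def by (rule guessable_diag) (use U V in \<open>simp add: G_def\<close>)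
    have UY: "y \<in> Y" if "y \<in> U" "a < y" for y using that unfolding Y_def G_def by auto
    have VY: "y \<in> Y" if "y \<in> V" "b < y" for y
      using that ab unfolding Y_def G_def by (intro CollectI exI[of _ b]) auto
    show "\<exists>Y\<in>Collect guessable. \<forall>x. F x - Y \<in> bounded_ideal \<and> stat (Y - F x)"
    proof (intro bexI[of _ Y] allI conjI)
      show "Y \<in> Collect guessable" using Y by simp
      fix x
      have "y \<le> max b x" if "y \<in> F x - Y" for y
      proof (rule ccontr)
        assume "\<not> y \<le> max b x"
        then have "max b x < y" by (simp only: not_le)
        then have "b < y" "x < y" by (meson max_less_iff_conj)+
        then show False using VY[of y] that unfolding V_def by blast
      qed
      then show "F x - Y \<in> bounded_ideal" by (rule bounded_idealI)
      show "stat (Y - F x)"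
      proof (rule stat_tail[OF U(2), of "max a x"])
        fix y assume y: "y \<in> U" "max a x < y"
        then have "y \<notin> F x" using U(1) unfolding V_def by auto
        then show "y \<in> Y - F x" using UY y by simp
      qed
    qed
  qed
  with nt show False by blast
qed

section \<open>The length of the chain of clubs, and the use of reflection\<close>

lemma countable_if_finite_initial:
  fixes \<mu> :: 'a
  assumes "\<And>b. b < \<mu> \<Longrightarrow> finite {..<b}"
  shows "countable {..<\<mu>}"
proof -
  have "inj_on (\<lambda>b. card {..<b}) {..<\<mu>}"
  proof (rule linorder_inj_onI)
    fix b c assume "b < c" "b \<in> {..<\<mu>}" "c \<in> {..<\<mu>}"
    then have "card {..<b} < card {..<c}" using assms by (intro psubset_card_mono) auto
    then show "card {..<b} \<noteq> card {..<c}" by simp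
  qed auto
  then show ?thesis by (rule countableI')
qed

text \<open>The hypothesis on \<open>\<theta>\<close> and \<open>\<rho>\<close> yields a regular \<open>\<mu> < \<rho>\<close> different from \<open>\<theta>\<close>, namely $\omega$ or
  $\omega_1$: a \<open>\<mu>\<close>-sequence below a point of cofinality \<open>\<theta>\<close> then has a cofinal bounded subsequence,
  while \<open>\<mu>\<close> many clubs still intersect well below points of cofinality at least \<open>\<rho>\<close>.\<close>

lemma chain_length:
  assumes inf: "infinite {..<\<theta>}"
    and big: "uncountable {..<\<theta>} \<or> (\<exists>\<beta><\<rho>. uncountable {..<\<beta>})"
  obtains \<mu> where "\<mu> < \<rho>" "lim_ord \<mu>"
    "\<And>\<delta> h. \<delta> \<in> S \<Longrightarrow> (\<And>i. i < \<mu> \<Longrightarrow> h i < \<delta>) \<Longrightarrow> \<exists>\<eta><\<delta>. \<forall>i<\<mu>. \<exists>j<\<mu>. i \<le> j \<and> h j \<le> \<eta>"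
proof (cases "uncountable {..<\<theta>}")
  case True
  \<comment> \<open>This \<open>\<mu>\<close> is omega, and \<open>\<theta>\<close> is uncountable
    in this case.\<close>
  define \<mu> where "\<mu> = (LEAST b. infinite {..<b :: 'a})"
  have inf\<mu>: "infinite {..<\<mu>}" unfolding \<mu>_def using inf by (rule LeastI)
  have fin: "finite {..<b}" if "b < \<mu>" for b using that not_less_Least unfolding \<mu>_def by blast
  have "\<mu> \<le> \<theta>" unfolding \<mu>_def using inf by (rule Least_le)
  show thesis
  proof
    show "\<mu> < \<rho>" using \<open>\<mu> \<le> \<theta>\<close> \<theta>\<rho> by simp
    show "lim_ord \<mu>"
      unfolding lim_ord_def
    proof (intro conjI allI impI)
      show "\<exists>\<beta>. \<beta> < \<mu>" using infinite_imp_nonempty[OF inf\<mu>] by auto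
      fix \<beta> assume \<beta>: "\<beta> < \<mu>"
      show "\<exists>\<delta>>\<beta>. \<delta> < \<mu>"
      proof (rule ccontr)
        assume no: "\<not> ?thesis"
        have "x \<in> insert \<beta> {..<\<beta>}" if "x < \<mu>" for x
          using no that by (cases x \<beta> rule: linorder_cases) auto
        then have "{..<\<mu>} \<subseteq> insert \<beta> {..<\<beta>}" by blast
        then show False using inf\<mu> fin[OF \<beta>] finite_subset by blast
      qed
    qed
    fix \<delta> and h :: "'a \<Rightarrow> 'a" assume \<delta>: "\<delta> \<in> S" and h: "\<And>i. i < \<mu> \<Longrightarrow> h i < \<delta>"
    show "\<exists>\<eta><\<delta>. \<forall>i<\<mu>. \<exists>j<\<mu>. i \<le> j \<and> h j \<le> \<eta>"
    proof (rule ccontr)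
      assume no: "\<not> ?thesis"
      \<comment> \<open>Without such an \<open>\<eta>\<close> the countable range of
        \<open>h\<close> would be cofinal in \<open>\<delta>\<close>, contradicting its uncountable
        cofinality.\<close>
      have "\<exists>i<\<mu>. x \<le> h i" if "x < \<delta>" for x
        using no that by (meson nle_le order_refl)
      then have "cofinal_in (h ` {..<\<mu>}) \<delta>" using h unfolding cofinal_in_def by auto
      then have "{..<\<theta>} \<lesssim> h ` {..<\<mu>}" using \<delta> S unfolding E_cf_def cf_eq_def by blast
      moreover have "countable (h ` {..<\<mu>})" using countable_if_finite_initial[OF fin] by simp
      ultimately show False using True countable_lepoll by blast
    qed
  qed
next
  case False
  then have ex: "\<exists>\<beta><\<rho>. uncountable {..<\<beta>}" using big by blast
  then obtain b0 where b0: "b0 < \<rho>" "uncountable {..<b0}" by blast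
  \<comment> \<open>This \<open>\<mu>\<close> is the first uncountable ordinal, and
    \<open>\<theta>\<close> is countable in this case.\<close>
  define \<mu> where "\<mu> = (LEAST b. uncountable {..<b :: 'a})"
  have unc: "uncountable {..<\<mu>}" unfolding \<mu>_def using b0(2) by (rule LeastI)
  have cnt: "countable {..<b}" if "b < \<mu>" for b using that not_less_Least unfolding \<mu>_def by blast
  have "\<mu> \<le> b0" unfolding \<mu>_def using b0(2) by (rule Least_le)
  show thesis
  proof
    show "\<mu> < \<rho>" using \<open>\<mu> \<le> b0\<close> b0(1) by simp
    show "lim_ord \<mu>"
      unfolding lim_ord_def
    proof (intro conjI allI impI)
      show "\<exists>\<beta>. \<beta> < \<mu>" using unc by (cases "{..<\<mu>} = {}") auto
      fix \<beta> assume \<beta>: "\<beta> < \<mu>"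
      show "\<exists>\<delta>>\<beta>. \<delta> < \<mu>"
      proof (rule ccontr)
        assume no: "\<not> ?thesis"
        have "x \<in> insert \<beta> {..<\<beta>}" if "x < \<mu>" for x
          using no that by (cases x \<beta> rule: linorder_cases) auto
        then have "{..<\<mu>} \<subseteq> insert \<beta> {..<\<beta>}" by blast
        then have "countable {..<\<mu>}" by (rule countable_subset) (simp add: cnt[OF \<beta>])
        with unc show False by simp
      qed
    qed
    fix \<delta> and h :: "'a \<Rightarrow> 'a" assume \<delta>: "\<delta> \<in> S" and h: "\<And>i. i < \<mu> \<Longrightarrow> h i < \<delta>"
    obtain C where C: "cofinal_in C \<delta>" "C \<approx> {..<\<theta>}" using \<delta> S unfolding E_cf_def cf_eq_def by blast
    have "countable C" using countable_eqpoll C(2) False by blast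
    show "\<exists>\<eta><\<delta>. \<forall>i<\<mu>. \<exists>j<\<mu>. i \<le> j \<and> h j \<le> \<eta>"
    proof (rule ccontr)
      assume no: "\<not> ?thesis"
      \<comment> \<open>Each \<open>c\<close> in the countable cofinal set is exceeded by
        \<open>h\<close> from some \<open>k c\<close> on. Countably many \<open>k c\<close> cannot
        be cofinal in \<open>\<mu>\<close>, so a single \<open>j\<close> would put
        \<open>h j\<close> above all of \<open>C\<close>.\<close>
      have "\<exists>i<\<mu>. \<forall>j<\<mu>. i \<le> j \<longrightarrow> c < h j" if "c \<in> C" for c
      proof -
        have "c < \<delta>" using C(1) that unfolding cofinal_in_def by blast
        then show ?thesis using no by (meson not_le)
      qed
      then obtain k where k: "\<And>c. c \<in> C \<Longrightarrow> k c < \<mu>" "\<And>c j. c \<in> C \<Longrightarrow> j < \<mu> \<Longrightarrow> k c \<le> j \<Longrightarrow> c < h j"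
        by metis
      have "countable (\<Union>c\<in>C. {..<k c})" using \<open>countable C\<close> cnt k(1) by (intro countable_UN) auto
      then have "\<not> {..<\<mu>} \<subseteq> (\<Union>c\<in>C. {..<k c})" using unc countable_subset by blast
      then obtain j where j0: "j < \<mu>" "j \<notin> (\<Union>c\<in>C. {..<k c})" by blast
      have j: "k c \<le> j" if "c \<in> C" for c using j0(2) that by (simp add: not_less)
      obtain c where "c \<in> C" "h j \<le> c" using C(1) h[OF j0(1)] unfolding cofinal_in_def by blast
      then show False using k(2)[OF _ j0(1) j, of c] by (simp add: not_less[symmetric])
    qed
  qed
qed

theorem kplus_tower_exists:
  assumes inf: "infinite {..<\<theta>}"
    and big: "uncountable {..<\<theta>} \<or> (\<exists>\<beta><\<rho>. uncountable {..<\<beta>})"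
    and refl: "reflects_fully S (E_cf_ge \<rho>)"
  shows kplus_tower
proof (rule ccontr)
  assume "\<not> kplus_tower"
  then obtain B where B: "\<And>D. club_in UNIV D \<Longrightarrow>
     \<exists>E. club_in UNIV E \<and> (\<forall>\<delta>\<in>S \<inter> E. good \<delta> (B \<delta>) D)"
    using guessable_S unfolding guessable_def by blast
  obtain G where G: "club_in UNIV G" "\<And>\<gamma>. \<gamma> \<in> G \<Longrightarrow> \<gamma> \<in> E_cf_ge \<rho> \<Longrightarrow> reflects_at S \<gamma>"
    using refl unfolding reflects_fully_def by blast
  obtain \<mu> where \<mu>: "\<mu> < \<rho>" "lim_ord \<mu>" and tail:
    "\<And>\<delta> h. \<delta> \<in> S \<Longrightarrow> (\<And>i. i < \<mu> \<Longrightarrow> h i < \<delta>) \<Longrightarrow> \<exists>\<eta><\<delta>. \<forall>i<\<mu>. \<exists>j<\<mu>. i \<le> j \<and> h j \<le> \<eta>"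
    using chain_length[OF inf big] by blast
  have "\<forall>D. \<exists>E. club_in UNIV D \<longrightarrow> club_in UNIV E \<and> (\<forall>\<delta>\<in>S \<inter> E. good \<delta> (B \<delta>) D)"
    using B by blast
  \<comment> \<open>\<open>e D\<close> is a club on which \<open>B\<close> guesses \<open>D\<close>
    at every point of \<open>S\<close>.\<close>
  then obtain e where e: "\<And>D. club_in UNIV D \<Longrightarrow> club_in UNIV (e D)"
    "\<And>D \<delta>. club_in UNIV D \<Longrightarrow> \<delta> \<in> S \<Longrightarrow> \<delta> \<in> e D \<Longrightarrow> good \<delta> (B \<delta>) D" by (metis IntI)
  have "\<exists>f. \<forall>i::'a. club_in UNIV (f i) \<and> f i \<subseteq> G \<and> (\<forall>j<i. f i \<subseteq> f j \<inter> limp (f j) \<inter> e (f j))"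
  proof (rule dependent_wellorder_choice)
    fix i :: 'a and f
    assume f: "\<And>j. j < i \<Longrightarrow> club_in UNIV (f j) \<and> f j \<subseteq> G \<and> (\<forall>k<j. f j \<subseteq> f k \<inter> limp (f k) \<inter> e (f k))"
    have "club_in UNIV (\<Inter>j\<in>{..<i}. f j \<inter> limp (f j) \<inter> e (f j))"
      by (rule club_Inter[OF not_lepoll_initial]) (use f e club_Int club_limp in auto)
    then have "club_in UNIV (G \<inter> (\<Inter>j\<in>{..<i}. f j \<inter> limp (f j) \<inter> e (f j)))" by (rule club_Int[OF G(1)])
    then show "\<exists>r. club_in UNIV r \<and> r \<subseteq> G \<and> (\<forall>j<i. r \<subseteq> f j \<inter> limp (f j) \<inter> e (f j))" by blast
  qed auto
  then obtain D where D0: "\<forall>i::'a. club_in UNIV (D i) \<and> D i \<subseteq> G \<and>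
    (\<forall>j<i. D i \<subseteq> D j \<inter> limp (D j) \<inter> e (D j))" ..
  have club: "club_in UNIV (D i)" and DG: "D i \<subseteq> G" for i using D0 by blast+
  have D: "D i \<subseteq> D j" "D i \<subseteq> limp (D j)" "D i \<subseteq> e (D j)" if "j < i" for i j using D0 that by blast+
  define K where "K = (\<Inter>i\<in>{..<\<mu>}. D i)"
  have K: "club_in UNIV K" unfolding K_def by (rule club_Inter[OF not_lepoll_initial club])
  obtain i0 where i0: "i0 < \<mu>" using \<mu>(2) by (auto simp: lim_ord_def)
  define \<gamma> where "\<gamma> = (LEAST \<gamma>. \<gamma> \<in> E_cf_ge \<rho> \<and> \<gamma> \<in> limp K)"
  have "\<exists>\<gamma>. \<gamma> \<in> E_cf_ge \<rho> \<and> \<gamma> \<in> limp K" using E_cf_ge_meets_club[OF club_limp[OF K]] by blast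
  then have \<gamma>: "\<gamma> \<in> E_cf_ge \<rho>" "\<gamma> \<in> limp K" 
    using LeastI_ex[of "\<lambda>\<gamma>. \<gamma> \<in> E_cf_ge \<rho> \<and> \<gamma> \<in> limp K"] unfolding \<gamma>_def by blast+
  have "K \<subseteq> G" using i0 DG unfolding K_def by blast
  then have "\<gamma> \<in> G" using \<gamma>(2) limp_mono[of K G] G(1) by (auto simp: club_UNIV_iff)
  then have "stationary_in {..<\<gamma>} (S \<inter> {..<\<gamma>})" using G(2) \<gamma>(1) unfolding reflects_at_def by blast
  moreover have "club_in {..<\<gamma>} (K \<inter> {..<\<gamma>})"
    unfolding club_in_def
  proof (intro conjI ballI impI)
    fix x assume "x \<in> {..<\<gamma>}"
    then show "\<exists>c\<in>K \<inter> {..<\<gamma>}. x \<le> c" using \<gamma>(2) by (auto simp: limp_def)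
  next
    fix \<beta> assume \<beta>: "\<beta> \<in> {..<\<gamma>}"
      "lim_ord \<beta> \<and> (\<forall>x<\<beta>. \<exists>c\<in>K \<inter> {..<\<gamma>}. x \<le> c \<and> c < \<beta>)"
    then have "\<beta> \<in> limp K" by (auto simp: limp_def)
    then show "\<beta> \<in> K \<inter> {..<\<gamma>}" using K \<beta> by (auto simp: club_UNIV_iff)
  qed simp
  ultimately obtain \<delta> where \<delta>: "\<delta> \<in> S" "\<delta> < \<gamma>" "\<delta> \<in> K" unfolding stationary_in_def by blast
  have next_ord: "\<exists>j<\<mu>. i < j" if "i < \<mu>" for i using \<mu>(2) that by (auto simp: lim_ord_def)
  have good: "good \<delta> (B \<delta>) (D i)" if i: "i < \<mu>" for i
  proof -
    \<comment> \<open>That \<open>\<mu>\<close> is a limit matters here: \<open>\<delta>\<close>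
      enters \<open>e (D i)\<close> through a later club \<open>D j\<close>.\<close>
    obtain j where "j < \<mu>" "i < j" using next_ord[OF i] by blast
    then have "\<delta> \<in> e (D i)" using \<delta>(3) D(3) unfolding K_def by blast
    then show ?thesis using e(2)[OF club \<delta>(1)] by blast
  qed
  then have "\<forall>i. \<exists>\<eta>. i < \<mu> \<longrightarrow> \<eta> < \<delta> \<and> (\<forall>x\<in>B \<delta>. \<eta> < x \<longrightarrow> x \<in> D i)"
    unfolding good_def by blast
  \<comment> \<open>\<open>h i\<close> bounds the exceptions to \<open>B \<delta>\<close> lying in
    \<open>D i\<close>. These bounds may be cofinal in \<open>\<delta>\<close>, but
    \<open>tail\<close> gives one \<open>\<eta>\<close> that serves for cofinally many
    \<open>i\<close>.\<close>
  then obtain h where h: "\<And>i. i < \<mu> \<Longrightarrow> h i < \<delta>"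
    "\<And>i x. i < \<mu> \<Longrightarrow> x \<in> B \<delta> \<Longrightarrow> h i < x \<Longrightarrow> x \<in> D i" by metis
  obtain \<eta> where \<eta>: "\<eta> < \<delta>" "\<And>i. i < \<mu> \<Longrightarrow> \<exists>j<\<mu>. i \<le> j \<and> h j \<le> \<eta>"
    using tail[of \<delta> h, OF \<delta>(1) h(1)] by blast
  obtain \<eta>' where "\<eta> < \<eta>'" "\<eta>' < \<delta>" using \<eta>(1) S_lim_ord[OF \<delta>(1)] by (auto simp: lim_ord_def)
  then obtain \<beta> where \<beta>: "\<beta> \<in> B \<delta>" "\<eta> < \<beta>"
    using good[OF i0] unfolding good_def by (meson order_less_le_trans)
  have \<beta>': "\<beta> < \<delta>" "\<beta> \<in> E_cf_ge \<rho>" using good[OF i0] \<beta>(1) unfolding good_def by blast+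
  have "\<beta> \<in> limp (D i)" if i: "i < \<mu>" for i
  proof -
    obtain k where k: "k < \<mu>" "i < k" using next_ord[OF i] by blast
    \<comment> \<open>Passing from \<open>i\<close> to a strictly later \<open>j\<close> with
      \<open>h j \<le> \<eta>\<close> turns membership in \<open>D j\<close> into being a limit of
      \<open>D i\<close>.\<close>
    obtain j where j: "j < \<mu>" "k \<le> j" "h j \<le> \<eta>" using \<eta>(2)[OF k(1)] by blast
    have "\<beta> \<in> D j" using h(2)[OF j(1) \<beta>(1)] j(3) \<beta>(2) by simp
    moreover have "i < j" using k j by simp
    ultimately show ?thesis using D(2) by blast
  qed
  \<comment> \<open>The cofinality of \<open>\<beta>\<close> is at least \<open>\<rho>\<close>, so
    being a limit of each of the fewer than \<open>\<rho>\<close> clubs makes it a limit of their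
    intersection.\<close>
  then have "\<beta> \<in> limp K"
    unfolding K_def using cf_ge_club_Inter[OF \<beta>'(2) not_lepoll_smaller[OF \<rho> \<mu>(1)], of D] club by auto
  then have "\<gamma> \<le> \<beta>" unfolding \<gamma>_def using \<beta>'(2) by (intro Least_le) simp
  then show False using \<beta>'(1) \<delta>(2) by simp
qed

end

theorem theorem5p12:
  fixes \<theta> \<rho> :: "'a::wellorder" and S :: "'a set"
  assumes "is_kappa TYPE('a)"
    and "regular_inf_cardinal \<theta>" and "regular_inf_cardinal \<rho>" and "\<theta> < \<rho>"
    and "S \<subseteq> E_cf \<theta>" and "stationary_in UNIV S"
    and "reflects_fully S (E_cf_ge \<rho>)"
    and "uncountable {..<\<theta>} \<or> (\<exists>\<beta><\<rho>. uncountable {..<\<beta>})"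
  shows "(\<exists>(w :: 'a set rel) A. has_length_bfrak TYPE('a) w \<and>
              desc_tower (NS_restr S) bounded_ideal w A) \<or>
         (\<exists>(w :: 'a set rel) A. has_length_kplus TYPE('a) w \<and>
              asc_tower (NS_restr S) bounded_ideal w A)"
proof -
  \<comment> \<open>Either alternative of the last hypothesis places an uncountable initial segment
    inside \<open>{..<\<rho>}\<close>.\<close>
  have "uncountable {..<\<rho>}"
  proof
    assume "countable {..<\<rho>}"
    then have "countable {..<b}" if "b \<le> \<rho>" for b
      by (rule countable_subset[rotated]) (use that in auto)
    then show False using assms(4,8) by (meson less_imp_le)
  qed
  then interpret reflecting_setup "TYPE('a)" \<theta> \<rho> S
    using assms by unfold_locales
  show ?thesis
    using kplus_tower_exists assms unfolding kplus_tower_def regular_inf_cardinal_def by blast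
qed

end
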